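(* Suppose the dyadic array satisfies the sampling scheme described in the context. Let $\mathcal F$ be a pointwise measurable, VC-type class of measurable real functions of a dyadic observation, with envelope $F$ satisfying $PF^2<\infty$. For each $f\in\mathcal F$ let $f_2$ be its second-order projection and $\mathbb U_nf_2=N_n^{-1}\sum_{1\le i<j\le n}f_2(U_i,U_j,U_{ij})$. Then $$E\Big[\sup_{f\in\mathcal F}|\mathbb U_nf_2|\Big]=O(n^{-1})\qquad(n\to\infty).$$
   Context: Sampling: node variables $(U_i)_{i\ge1}$ are i.i.d., dyad variables $(U_{ij})_{i<j}$ are i.i.d., and all of these are mutually independent. For $i<j$, $Z_{ij}=(Y_{ij},X_{ij}')'=\tau(U_i,U_j,U_{ij})$ with $\tau$ measurable and symmetric in its first two arguments, $Y_{ij}$ real and $X_{ij}\in\mathcal X\subset\mathbb R^d$ a compact rectangle. (Thus the array is jointly exchangeable and dissociated.) For $j<i$ set $Z_{ij}=Z_{ji}$, $U_{ij}=U_{ji}$. One observes $Z_{ij}$, $1\le i<j\le n$; $N_n=n(n-1)/2$; $Pf=E[f(Z_{12})]$. Projections: for square-integrable $f$, $f_1(u)=E[f(Z_{12})\mid U_1=u]-Pf$ and $f_2(u,v,w)=f\{\tau(u,v,w)\}-Pf-f_1(u)-f_1(v)$. $\mathcal F$ is VC type with envelope $F$ if $|f|\le F$ for all $f\in\mathcal F$ and there are finite constants $A,v$ with $\sup_Q N(\epsilon\|F\|_{Q,2},\mathcal F,L_2(Q))\le (A/\epsilon)^v$ for all $0<\epsilon\le1$, the supremum being over probability measures $Q$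 (with $0<\|F\|_{Q,2}<\infty$), $\|f\|_{Q,2}=(Q|f|^2)^{1/2}$, and $N$ denoting covering numbers. $\mathcal F$ is pointwise measurable if it has a countable subclass such that each $f\in\mathcal F$ is a pointwise limit of a sequence from it. *)

theory Defs
  imports "HOL-Probability.Probability"
begin

section \<open>Dyadic arrays\<close>

text \<open>
  A dyadic observation is a pair (outcome, regressors). Its space is the product of the real line and
  the regressor rectangle, so that the behaviour of functions off the rectangle is irrelevant.
\<close>

abbreviation obs_space :: "(real^'d) set \<Rightarrow> (real \<times> (real^'d)) measure" where
  "obs_space \<X> \<equiv> borel \<Otimes>\<^sub>M restrict_space borel \<X>"

text \<open>
  \<open>U i\<close> (\<open>1 \<le> i\<close>) are the node variables and \<open>V i j\<close> (\<open>1 \<le> i < j\<close>) the dyad variables; their values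
  at other indices are unconstrained and never used. Node and dyad variables may have different value
  types, which \<open>indep_vars\<close> does not allow. Mutual independence of the whole family is therefore
  expressed by \<open>indep_sets\<close> applied to the sigma-algebras generated by the individual variables,
  indexed by a sum type.
\<close>

locale dyadic_array = prob_space M
  for M :: "'w measure" +
  fixes S :: "'s measure" and T :: "'t measure"
    and U :: "nat \<Rightarrow> 'w \<Rightarrow> 's" and V :: "nat \<Rightarrow> nat \<Rightarrow> 'w \<Rightarrow> 't"
    and \<tau> :: "'s \<Rightarrow> 's \<Rightarrow> 't \<Rightarrow> real \<times> (real^'d)" and \<X> :: "(real^'d) set"
  assumes regressor_rectangle: "\<exists>a b. \<X> = cbox a b"
    and node_measurable: "\<And>i. 1 \<le> i \<Longrightarrow> U i \<in> measurable M S"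
    and dyad_measurable: "\<And>i j. 1 \<le> i \<Longrightarrow> i < j \<Longrightarrow> V i j \<in> measurable M T"
    and node_identical: "\<And>i. 1 \<le> i \<Longrightarrow> distr M S (U i) = distr M S (U 1)"
    and dyad_identical: "\<And>i j. 1 \<le> i \<Longrightarrow> i < j \<Longrightarrow> distr M T (V i j) = distr M T (V 1 2)"
    and independent: "indep_sets
          (case_sum (\<lambda>i. {U i -` A \<inter> space M |A. A \<in> sets S})
                    (\<lambda>(i, j). {V i j -` A \<inter> space M |A. A \<in> sets T}))
          ({Inl i |i. 1 \<le> i} \<union> {Inr (i, j) |i j. 1 \<le> i \<and> i < j})"
    and tau_measurable: "(\<lambda>(u, v, w). \<tau> u v w) \<in> measurable (S \<Otimes>\<^sub>M S \<Otimes>\<^sub>M T) (obs_space \<X>)"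
    and tau_symmetric: "\<And>u v w. u \<in> space S \<Longrightarrow> v \<in> space S \<Longrightarrow> w \<in> space T \<Longrightarrow> \<tau> u v w = \<tau> v u w"

text \<open>\<open>min\<close> and \<open>max\<close> implement the convention that the dyad variable of \<open>(j, i)\<close> is that of \<open>(i, j)\<close>.\<close>

definition dyad_obs ::
  "(nat \<Rightarrow> 'w \<Rightarrow> 's) \<Rightarrow> (nat \<Rightarrow> nat \<Rightarrow> 'w \<Rightarrow> 't) \<Rightarrow> ('s \<Rightarrow> 's \<Rightarrow> 't \<Rightarrow> 'z) \<Rightarrow> nat \<Rightarrow> nat \<Rightarrow> 'w \<Rightarrow> 'z" where
  "dyad_obs U V \<tau> i j \<omega> = \<tau> (U i \<omega>) (U j \<omega>) (V (min i j) (max i j) \<omega>)"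

definition obs_law ::
  "'w measure \<Rightarrow> (nat \<Rightarrow> 'w \<Rightarrow> 's) \<Rightarrow> (nat \<Rightarrow> nat \<Rightarrow> 'w \<Rightarrow> 't) \<Rightarrow>
   ('s \<Rightarrow> 's \<Rightarrow> 't \<Rightarrow> real \<times> (real^'d)) \<Rightarrow> (real^'d) set \<Rightarrow> (real \<times> (real^'d)) measure" where
  "obs_law M U V \<tau> \<X> = distr M (obs_space \<X>) (dyad_obs U V \<tau> 1 2)"

section \<open>Projections\<close>

text \<open>
  The conditional expectation of \<open>f\<close> at the first observation given that the first node variable is \<open>u\<close>.
  A supremum over an uncountable class of functions is meaningful only if the versions of the
  conditional expectations are chosen consistently over the class. By independence of the node
  variable from \<open>(U 2, V 1 2)\<close>, a canonical version is obtained by freezing its value at \<open>u\<close>;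
  \<open>cond_mean_is_cond_exp\<close> below shows that it is indeed a conditional expectation.
\<close>

definition cond_mean ::
  "'w measure \<Rightarrow> (nat \<Rightarrow> 'w \<Rightarrow> 's) \<Rightarrow> (nat \<Rightarrow> nat \<Rightarrow> 'w \<Rightarrow> 't) \<Rightarrow> ('s \<Rightarrow> 's \<Rightarrow> 't \<Rightarrow> 'z) \<Rightarrow>
   ('z \<Rightarrow> real) \<Rightarrow> 's \<Rightarrow> real" where
  "cond_mean M U V \<tau> f u = (\<integral>\<omega>. f (\<tau> u (U 2 \<omega>) (V 1 2 \<omega>)) \<partial>M)"

definition proj1 ::
  "'w measure \<Rightarrow> (nat \<Rightarrow> 'w \<Rightarrow> 's) \<Rightarrow> (nat \<Rightarrow> nat \<Rightarrow> 'w \<Rightarrow> 't) \<Rightarrow>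
   ('s \<Rightarrow> 's \<Rightarrow> 't \<Rightarrow> real \<times> (real^'d)) \<Rightarrow> (real^'d) set \<Rightarrow>
   (real \<times> (real^'d) \<Rightarrow> real) \<Rightarrow> 's \<Rightarrow> real" where
  "proj1 M U V \<tau> \<X> f u = cond_mean M U V \<tau> f u - (\<integral>z. f z \<partial>obs_law M U V \<tau> \<X>)"

definition proj2 ::
  "'w measure \<Rightarrow> (nat \<Rightarrow> 'w \<Rightarrow> 's) \<Rightarrow> (nat \<Rightarrow> nat \<Rightarrow> 'w \<Rightarrow> 't) \<Rightarrow>
   ('s \<Rightarrow> 's \<Rightarrow> 't \<Rightarrow> real \<times> (real^'d)) \<Rightarrow> (real^'d) set \<Rightarrow>
   (real \<times> (real^'d) \<Rightarrow> real) \<Rightarrow> 's \<Rightarrow> 's \<Rightarrow> 't \<Rightarrow> real" where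
  "proj2 M U V \<tau> \<X> f u v w =
     f (\<tau> u v w) - (\<integral>z. f z \<partial>obs_law M U V \<tau> \<X>) - proj1 M U V \<tau> \<X> f u - proj1 M U V \<tau> \<X> f v"

definition dyadic_mean ::
  "(nat \<Rightarrow> 'w \<Rightarrow> 's) \<Rightarrow> (nat \<Rightarrow> nat \<Rightarrow> 'w \<Rightarrow> 't) \<Rightarrow> nat \<Rightarrow> ('s \<Rightarrow> 's \<Rightarrow> 't \<Rightarrow> real) \<Rightarrow> 'w \<Rightarrow> real" where
  "dyadic_mean U V n g \<omega> =
     (\<Sum>i=1..n. \<Sum>j=i+1..n. g (U i \<omega>) (U j \<omega>) (V i j \<omega>)) / (real n * (real n - 1) / 2)"

section \<open>Function classes\<close>

definition L2_seminorm :: "'z measure \<Rightarrow> ('z \<Rightarrow> real) \<Rightarrow> real" where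
  "L2_seminorm Q f = sqrt (\<integral>z. (f z)\<^sup>2 \<partial>Q)"

text \<open>Centers need not belong to the class, but must have finite norm. The value is infinite if no finite
  cover exists.\<close>

definition covering_number :: "real \<Rightarrow> ('z \<Rightarrow> real) set \<Rightarrow> 'z measure \<Rightarrow> enat" where
  "covering_number \<epsilon> \<F> Q = Inf {enat (card C) |C. finite C \<and>
     (\<forall>g\<in>C. g \<in> borel_measurable Q \<and> integrable Q (\<lambda>z. (g z)\<^sup>2)) \<and>
     (\<forall>f\<in>\<F>. \<exists>g\<in>C. L2_seminorm Q (\<lambda>z. f z - g z) < \<epsilon>)}"

definition VC_type :: "'z measure \<Rightarrow> ('z \<Rightarrow> real) set \<Rightarrow> ('z \<Rightarrow> real) \<Rightarrow> bool" where
  "VC_type Z \<F> F \<longleftrightarrow>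
     (\<forall>f\<in>\<F>. \<forall>z\<in>space Z. \<bar>f z\<bar> \<le> F z) \<and>
     (\<exists>A v. 0 < A \<and> (\<forall>\<epsilon>. 0 < \<epsilon> \<longrightarrow> \<epsilon> \<le> 1 \<longrightarrow>
        (SUP Q \<in> {Q. prob_space Q \<and> sets Q = sets Z \<and>
                     integrable Q (\<lambda>z. (F z)\<^sup>2) \<and> 0 < L2_seminorm Q F}.
           ennreal_of_enat (covering_number (\<epsilon> * L2_seminorm Q F) \<F> Q))
        \<le> ennreal ((A / \<epsilon>) powr v)))"

definition pointwise_measurable :: "'z set \<Rightarrow> ('z \<Rightarrow> real) set \<Rightarrow> bool" where
  "pointwise_measurable \<Omega> \<F> \<longleftrightarrow>
     (\<exists>\<G>\<subseteq>\<F>. countable \<G> \<and>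
        (\<forall>f\<in>\<F>. \<exists>g. (\<forall>k. g k \<in> \<G>) \<and> (\<forall>z\<in>\<Omega>. (\<lambda>k. g k z) \<longlonglongrightarrow> f z)))"

section \<open>Well-definedness\<close>

context dyadic_array
begin

context
  notes One_nat_def [simp del]
begin

abbreviation "node_law \<equiv> distr M S (U 1)"
abbreviation "rest_law \<equiv> distr M (S \<Otimes>\<^sub>M T) (\<lambda>\<omega>. (U 2 \<omega>, V 1 2 \<omega>))"

lemma U_meas [measurable]: "U 1 \<in> measurable M S" "U 2 \<in> measurable M S"
  and V_meas [measurable]: "V 1 2 \<in> measurable M T"
  by (auto intro: node_measurable dyad_measurable)

lemma tau_comp_measurable [measurable (raw)]:
  assumes [measurable]: "a \<in> measurable N S" "b \<in> measurable N S" "c \<in> measurable N T"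
  shows "(\<lambda>x. \<tau> (a x) (b x) (c x)) \<in> measurable N (obs_space \<X>)"
proof -
  have "(\<lambda>x. (\<lambda>(u, v, w). \<tau> u v w) (a x, b x, c x)) \<in> measurable N (obs_space \<X>)"
    by (rule measurable_compose[OF _ tau_measurable]) measurable
  then show ?thesis by simp
qed

lemma dyad_obs_12: "dyad_obs U V \<tau> 1 2 = (\<lambda>\<omega>. \<tau> (U 1 \<omega>) (U 2 \<omega>) (V 1 2 \<omega>))"
  by (simp add: dyad_obs_def fun_eq_iff)

lemma dyad_obs_measurable [measurable]: "dyad_obs U V \<tau> 1 2 \<in> measurable M (obs_space \<X>)"
  unfolding dyad_obs_12 by measurable

lemma joint_law:
  "distr M (S \<Otimes>\<^sub>M (S \<Otimes>\<^sub>M T)) (\<lambda>\<omega>. (U 1 \<omega>, U 2 \<omega>, V 1 2 \<omega>)) = node_law \<Otimes>\<^sub>M rest_law"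
proof -
  define E where "E = case_sum (\<lambda>i. {U i -` A \<inter> space M |A. A \<in> sets S})
                    (\<lambda>(i, j). {V i j -` A \<inter> space M |A. A \<in> sets T})"
  define I where "I = case_bool {Inl 1 :: nat + nat \<times> nat} {Inl 2, Inr (1, 2)}"
  have sub: "(\<Union>b. I b) \<subseteq> {Inl i |i. 1 \<le> i} \<union> {Inr (i, j) |i j. 1 \<le> i \<and> i < j}"
    unfolding I_def UNIV_bool by fastforce
  have ind: "indep_sets E (\<Union>b. I b)"
    using indep_sets_mono_index[OF sub] independent unfolding E_def by blast
  have stableU: "Int_stable {X -` A \<inter> space M |A. A \<in> sets S}" for X :: "'w \<Rightarrow> 's"
  proof (rule Int_stableI, clarify)
    fix A B assume "A \<in> sets S" "B \<in> sets S"
    then show "\<exists>C. X -` A \<inter> space M \<inter> (X -` B \<inter> space M) = X -` C \<inter> space M \<and> C \<in> sets S"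
      by (intro exI[of _ "A \<inter> B"]) auto
  qed
  have stableV: "Int_stable {X -` A \<inter> space M |A. A \<in> sets T}" for X :: "'w \<Rightarrow> 't"
  proof (rule Int_stableI, clarify)
    fix A B assume "A \<in> sets T" "B \<in> sets T"
    then show "\<exists>C. X -` A \<inter> space M \<inter> (X -` B \<inter> space M) = X -` C \<inter> space M \<and> C \<in> sets T"
      by (intro exI[of _ "A \<inter> B"]) auto
  qed
  have stable: "Int_stable (E i)" for i
    using stableU stableV by (cases i) (auto simp: E_def split: prod.splits)
  have "disjoint_family_on I UNIV"
    by (auto simp: disjoint_family_on_def I_def split: bool.splits)
  from indep_sets_collect_sigma[OF ind stable this]
  have ind2: "indep_sets (\<lambda>b. sigma_sets (space M) (\<Union>i\<in>I b. E i)) UNIV" .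
  interpret X: prob_space node_law by (rule prob_space_distr) measurable
  interpret Y: prob_space rest_law by (rule prob_space_distr) measurable
  interpret XY: pair_prob_space node_law rest_law ..
  show ?thesis
  proof (rule pair_measure_eqI[symmetric])
    show "sigma_finite_measure node_law" "sigma_finite_measure rest_law" by unfold_locales
    fix A B assume A: "A \<in> sets node_law" and B: "B \<in> sets rest_law"
    then have [measurable]: "A \<in> sets S" "B \<in> sets (S \<Otimes>\<^sub>M T)" by auto
    let ?A = "U 1 -` A \<inter> space M" and ?B = "(\<lambda>\<omega>. (U 2 \<omega>, V 1 2 \<omega>)) -` B \<inter> space M"
    have EE: "E i \<subseteq> Pow (space M)" for i
      by (cases i) (auto simp: E_def)
    let ?N = "sigma (space M) (\<Union>i\<in>I False. E i)"
    have sN: "sets ?N = sigma_sets (space M) (\<Union>i\<in>I False. E i)" "space ?N = space M"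
      using EE by (auto intro!: sets_measure_of space_measure_of)
    have "U 2 \<in> measurable ?N S"
    proof (rule measurableI)
      show "U 2 x \<in> space S" if "x \<in> space ?N" for x
        using measurable_space[OF U_meas(2)] that sN by auto
      show "U 2 -` C \<inter> space ?N \<in> sets ?N" if "C \<in> sets S" for C
        unfolding sN using that by (intro sigma_sets.Basic) (auto simp: I_def E_def)
    qed
    moreover have "V 1 2 \<in> measurable ?N T"
    proof (rule measurableI)
      show "V 1 2 x \<in> space T" if "x \<in> space ?N" for x
        using measurable_space[OF V_meas] that sN by auto
      show "V 1 2 -` C \<inter> space ?N \<in> sets ?N" if "C \<in> sets T" for C
        unfolding sN using that by (intro sigma_sets.Basic) (auto simp: I_def E_def)
    qed
    ultimately have "(\<lambda>\<omega>. (U 2 \<omega>, V 1 2 \<omega>)) \<in> measurable ?N (S \<Otimes>\<^sub>M T)"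
      by (rule measurable_Pair)
    from measurable_sets[OF this, of B]
    have mB: "?B \<in> sigma_sets (space M) (\<Union>i\<in>I False. E i)"
      unfolding sN by auto
    have mA: "?A \<in> sigma_sets (space M) (\<Union>i\<in>I True. E i)"
      by (intro sigma_sets.Basic) (auto simp: I_def E_def)
    have "prob (\<Inter>b\<in>UNIV. case_bool ?A ?B b) = (\<Prod>b\<in>UNIV. prob (case_bool ?A ?B b))"
      using mA mB by (intro indep_setsD[OF ind2]) (auto split: bool.splits)
    then have pr: "prob (?A \<inter> ?B) = prob ?A * prob ?B"
      by (simp add: UNIV_bool INT_bool_eq Int_commute mult.commute)
    have "emeasure (distr M (S \<Otimes>\<^sub>M (S \<Otimes>\<^sub>M T)) (\<lambda>\<omega>. (U 1 \<omega>, U 2 \<omega>, V 1 2 \<omega>))) (A \<times> B)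
        = emeasure M (?A \<inter> ?B)"
      by (subst emeasure_distr) (auto intro!: arg_cong[where f="emeasure M"])
    also have "\<dots> = emeasure M ?A * emeasure M ?B"
      by (simp add: emeasure_eq_measure pr ennreal_mult)
    also have "\<dots> = emeasure node_law A * emeasure rest_law B"
      by (simp add: emeasure_distr)
    finally show "emeasure node_law A * emeasure rest_law B =
      emeasure (distr M (S \<Otimes>\<^sub>M (S \<Otimes>\<^sub>M T)) (\<lambda>\<omega>. (U 1 \<omega>, U 2 \<omega>, V 1 2 \<omega>))) (A \<times> B)" ..
  qed simp
qed

lemma cond_mean_rest_law:
  fixes f :: "_ \<Rightarrow> real"
  assumes [measurable]: "f \<in> borel_measurable (obs_space \<X>)" and u: "u \<in> space S"
  shows "cond_mean M U V \<tau> f u = (\<integral>y. f (\<tau> u (fst y) (snd y)) \<partial>rest_law)"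
  unfolding cond_mean_def using u by (subst integral_distr) auto

lemma cond_mean_measurable [measurable]:
  fixes f :: "_ \<Rightarrow> real"
  assumes [measurable]: "f \<in> borel_measurable (obs_space \<X>)"
  shows "cond_mean M U V \<tau> f \<in> borel_measurable S"
  unfolding cond_mean_def by measurable

lemma integrable_joint:
  fixes f :: "_ \<Rightarrow> real"
  assumes [measurable]: "f \<in> borel_measurable (obs_space \<X>)" and "integrable (obs_law M U V \<tau> \<X>) f"
  shows "integrable (node_law \<Otimes>\<^sub>M rest_law) (\<lambda>(u, y). f (\<tau> u (fst y) (snd y)))"
proof -
  have "integrable M (\<lambda>\<omega>. f (dyad_obs U V \<tau> 1 2 \<omega>))"
    using assms(2) unfolding obs_law_def by (rule integrable_distr[OF dyad_obs_measurable])
  then have "integrable M (\<lambda>\<omega>. f (\<tau> (U 1 \<omega>) (U 2 \<omega>) (V 1 2 \<omega>)))"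
    unfolding dyad_obs_12 .
  then show ?thesis
    unfolding joint_law[symmetric] by (subst integrable_distr_eq) auto
qed

lemma cond_mean_is_cond_exp:
  fixes f :: "_ \<Rightarrow> real"
  assumes [measurable]: "f \<in> borel_measurable (obs_space \<X>)" and f: "integrable (obs_law M U V \<tau> \<X>) f"
  shows "AE \<omega> in M. real_cond_exp M (vimage_algebra (space M) (U 1) S)
            (\<lambda>\<omega>. f (dyad_obs U V \<tau> 1 2 \<omega>)) \<omega> = cond_mean M U V \<tau> f (U 1 \<omega>)"
proof -
  interpret X: prob_space node_law by (rule prob_space_distr) measurable
  interpret Y: prob_space rest_law by (rule prob_space_distr) measurable
  interpret XY: pair_prob_space node_law rest_law ..
  let ?G = "vimage_algebra (space M) (U 1) S"
  have U_into: "U 1 \<in> space M \<rightarrow> space S"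
    using measurable_space[OF U_meas(1)] by auto
  have sub: "subalgebra M ?G"
    unfolding subalgebra_def sets_vimage_algebra2[OF U_into] by auto
  interpret finite_measure_subalgebra M ?G
    by unfold_locales (rule sub)
  note ij = integrable_joint[OF assms]
  have int_cm: "integrable node_law (cond_mean M U V \<tau> f)"
    using XY.integrable_fst'[OF ij]
    by (subst Bochner_Integration.integrable_cong[OF refl])
       (auto simp: cond_mean_rest_law split_beta')
  show ?thesis
  proof (rule real_cond_exp_charact)
    show "integrable M (\<lambda>\<omega>. f (dyad_obs U V \<tau> 1 2 \<omega>))"
      using f unfolding obs_law_def by (subst (asm) integrable_distr_eq) auto
    show "integrable M (\<lambda>\<omega>. cond_mean M U V \<tau> f (U 1 \<omega>))"
      using int_cm by (subst (asm) integrable_distr_eq) auto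
    show "(\<lambda>\<omega>. cond_mean M U V \<tau> f (U 1 \<omega>)) \<in> borel_measurable ?G"
      by (rule measurable_compose[OF measurable_vimage_algebra1[OF U_into]]) measurable
    fix A assume "A \<in> sets ?G"
    then obtain B where [measurable]: "B \<in> sets S" and A: "A = U 1 -` B \<inter> space M"
      by (auto simp: sets_vimage_algebra2[OF U_into])
    have ind: "indicator A \<omega> = (indicator B (U 1 \<omega>) :: real)" if "\<omega> \<in> space M" for \<omega>
      using that by (auto simp: A indicator_def)
    let ?h = "\<lambda>(u, y). indicator B u * f (\<tau> u (fst y) (snd y))"
    have ih: "integrable (node_law \<Otimes>\<^sub>M rest_law) ?h"
      by (rule Bochner_Integration.integrable_bound[OF ij]) (auto simp: indicator_def)
    have "(\<integral>\<omega>\<in>A. f (dyad_obs U V \<tau> 1 2 \<omega>) \<partial>M)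
        = (\<integral>\<omega>. ?h (U 1 \<omega>, U 2 \<omega>, V 1 2 \<omega>) \<partial>M)"
      unfolding set_lebesgue_integral_def
      by (rule Bochner_Integration.integral_cong) (auto simp: ind dyad_obs_12)
    also have "\<dots> = (\<integral>x. ?h x \<partial>(node_law \<Otimes>\<^sub>M rest_law))"
      unfolding joint_law[symmetric] by (subst integral_distr) auto
    also have "\<dots> = (\<integral>u. \<integral>y. ?h (u, y) \<partial>rest_law \<partial>node_law)"
      by (rule XY.integral_fst'[OF ih, symmetric])
    also have "\<dots> = (\<integral>u. indicator B u * cond_mean M U V \<tau> f u \<partial>node_law)"
      by (rule Bochner_Integration.integral_cong) (auto simp: cond_mean_rest_law)
    also have "\<dots> = (\<integral>\<omega>. indicator B (U 1 \<omega>) * cond_mean M U V \<tau> f (U 1 \<omega>) \<partial>M)"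
      by (subst integral_distr) auto
    also have "\<dots> = (\<integral>\<omega>\<in>A. cond_mean M U V \<tau> f (U 1 \<omega>) \<partial>M)"
      unfolding set_lebesgue_integral_def
      by (rule Bochner_Integration.integral_cong) (auto simp: ind)
    finally show "(\<integral>\<omega>\<in>A. f (dyad_obs U V \<tau> 1 2 \<omega>) \<partial>M) = (\<integral>\<omega>\<in>A. cond_mean M U V \<tau> f (U 1 \<omega>) \<partial>M)" .
  qed
qed

text \<open>
  The supremum over a pointwise measurable class agrees almost surely with the supremum over a
  countable subclass. Hence it is measurable for the completed measure, and its \<open>nn_integral\<close>
  is a genuine expectation rather than a mere lower integral.
\<close>

lemma Sup_dyadic_mean_countable:
  assumes F_sub: "\<F> \<subseteq> borel_measurable (obs_space \<X>)"
    and pm: "pointwise_measurable (space (obs_space \<X>)) \<F>"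
    and F_meas [measurable]: "F \<in> borel_measurable (obs_space \<X>)"
    and env: "\<And>f z. f \<in> \<F> \<Longrightarrow> z \<in> space (obs_space \<X>) \<Longrightarrow> \<bar>f z\<bar> \<le> F z"
    and F2: "integrable (obs_law M U V \<tau> \<X>) (\<lambda>z. (F z)\<^sup>2)"
  shows "\<exists>H\<in>borel_measurable M. AE \<omega> in M.
    (SUP f\<in>\<F>. ennreal \<bar>dyadic_mean U V n (proj2 M U V \<tau> \<X> f) \<omega>\<bar>) = H \<omega>"
proof -
  interpret X: prob_space node_law by (rule prob_space_distr) measurable
  interpret Y: prob_space rest_law by (rule prob_space_distr) measurable
  interpret XY: pair_prob_space node_law rest_law ..
  interpret P: prob_space "obs_law M U V \<tau> \<X>"
    unfolding obs_law_def by (rule prob_space_distr) measurable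
  have law [simp]: "sets (obs_law M U V \<tau> \<X>) = sets (obs_space \<X>)"
      "space (obs_law M U V \<tau> \<X>) = space (obs_space \<X>)"
    by (simp_all add: obs_law_def)
  have law_meas: "measurable (obs_law M U V \<tau> \<X>) N = measurable (obs_space \<X>) N" for N :: "real measure"
    by (rule measurable_cong_sets) simp_all
  obtain \<G> where G: "\<G> \<subseteq> \<F>" "countable \<G>"
    and Glim: "\<And>f. f \<in> \<F> \<Longrightarrow> \<exists>g. (\<forall>k. g k \<in> \<G>) \<and> (\<forall>z\<in>space (obs_space \<X>). (\<lambda>k. g k z) \<longlonglongrightarrow> f z)"
    using pm unfolding pointwise_measurable_def by metis
  have F_int: "integrable (obs_law M U V \<tau> \<X>) F"
    by (rule P.square_integrable_imp_integrable[OF _ F2]) (simp add: law_meas)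
  let ?U = "\<lambda>f. dyadic_mean U V n (proj2 M U V \<tau> \<X> f)"
  define H where "H \<omega> = (SUP g\<in>\<G>. ennreal \<bar>?U g \<omega>\<bar>)" for \<omega>
  have U_meas': "?U f \<in> borel_measurable M" if "f \<in> \<F>" for f
  proof -
    have [measurable]: "f \<in> borel_measurable (obs_space \<X>)" using that F_sub by auto
    have "(\<lambda>\<omega>. proj2 M U V \<tau> \<X> f (U i \<omega>) (U j \<omega>) (V i j \<omega>)) \<in> borel_measurable M"
      if "1 \<le> i" "i < j" for i j
    proof -
      have [measurable]: "U i \<in> measurable M S" "U j \<in> measurable M S" "V i j \<in> measurable M T"
        using that by (auto intro: node_measurable dyad_measurable)
      show ?thesis unfolding proj2_def proj1_def by measurable
    qed
    then show ?thesis
      unfolding dyadic_mean_def by (intro borel_measurable_divide borel_measurable_sum) auto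
  qed
  have "H \<in> borel_measurable M"
    unfolding H_def using G U_meas' by (intro borel_measurable_SUP) auto
  moreover have "AE \<omega> in M. (SUP f\<in>\<F>. ennreal \<bar>?U f \<omega>\<bar>) = H \<omega>"
  proof -
    let ?good = "\<lambda>u. integrable rest_law (\<lambda>y. F (\<tau> u (fst y) (snd y)))"
    have "AE u in node_law. ?good u"
      using XY.AE_integrable_fst'[OF integrable_joint[OF F_meas F_int]] by simp
    then have "AE u in distr M S (U i). ?good u" if "1 \<le> i" for i
      unfolding node_identical[OF that] .
    then have "AE \<omega> in M. ?good (U i \<omega>)" if "1 \<le> i" for i
      using that by (intro AE_distrD[OF node_measurable]) auto
    then have "AE \<omega> in M. \<forall>i\<in>{1..n}. ?good (U i \<omega>)"
      by (intro AE_finite_allI) auto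
    then show ?thesis
    proof (rule AE_mp, intro AE_I2 impI)
      fix \<omega> assume \<omega>: "\<omega> \<in> space M" and good: "\<forall>i\<in>{1..n}. ?good (U i \<omega>)"
      have Usp: "U i \<omega> \<in> space S" if "1 \<le> i" for i
        using measurable_space[OF node_measurable[OF that] \<omega>] .
      have Vsp: "V i j \<omega> \<in> space T" if "1 \<le> i" "i < j" for i j
        using measurable_space[OF dyad_measurable[OF that] \<omega>] .
      have tau_sp: "\<tau> u v w \<in> space (obs_space \<X>)" if "u \<in> space S" "v \<in> space S" "w \<in> space T" for u v w
        using measurable_space[OF tau_measurable, of "(u, v, w)"] that by (auto simp: space_pair_measure)
      have "ennreal \<bar>?U f \<omega>\<bar> \<le> H \<omega>" if f: "f \<in> \<F>" for f
      proof -
        obtain g where gG: "\<And>k. g k \<in> \<G>"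
          and lim: "\<And>z. z \<in> space (obs_space \<X>) \<Longrightarrow> (\<lambda>k. g k z) \<longlonglongrightarrow> f z"
          using Glim[OF f] by blast
        have gF: "g k \<in> \<F>" for k using gG G by auto
        have [measurable]: "f \<in> borel_measurable (obs_space \<X>)" "\<And>k. g k \<in> borel_measurable (obs_space \<X>)"
          using F_sub f gF by auto
        have P_lim: "(\<lambda>k. \<integral>z. g k z \<partial>obs_law M U V \<tau> \<X>) \<longlonglongrightarrow> (\<integral>z. f z \<partial>obs_law M U V \<tau> \<X>)"
          by (rule integral_dominated_convergence[OF _ _ F_int])
             (auto simp: law_meas intro!: lim env gF AE_I2)
        have cm_lim: "(\<lambda>k. cond_mean M U V \<tau> (g k) (U i \<omega>)) \<longlonglongrightarrow> cond_mean M U V \<tau> f (U i \<omega>)"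
          if i: "i \<in> {1..n}" for i
        proof -
          have u [measurable]: "U i \<omega> \<in> space S" using Usp i by simp
          have "(\<lambda>k. \<integral>y. g k (\<tau> (U i \<omega>) (fst y) (snd y)) \<partial>rest_law)
              \<longlonglongrightarrow> (\<integral>y. f (\<tau> (U i \<omega>) (fst y) (snd y)) \<partial>rest_law)"
          proof (rule integral_dominated_convergence[where w="\<lambda>y. F (\<tau> (U i \<omega>) (fst y) (snd y))"])
            show "?good (U i \<omega>)" using good i by blast
          qed (use u in \<open>auto simp: space_pair_measure intro!: lim env gF AE_I2 tau_sp\<close>)
          then show ?thesis using u by (simp add: cond_mean_rest_law)
        qed
        have "(\<lambda>k. ?U (g k) \<omega>) \<longlonglongrightarrow> ?U f \<omega>"
          unfolding dyadic_mean_def proj2_def proj1_def divide_inverse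
        proof (intro tendsto_mult_right tendsto_sum tendsto_diff P_lim cm_lim lim tau_sp)
        qed (use Usp Vsp in auto)
        then have "(\<lambda>k. ennreal \<bar>?U (g k) \<omega>\<bar>) \<longlonglongrightarrow> ennreal \<bar>?U f \<omega>\<bar>"
          by (intro tendsto_ennrealI tendsto_rabs)
        moreover have "ennreal \<bar>?U (g k) \<omega>\<bar> \<le> H \<omega>" for k
          unfolding H_def by (rule SUP_upper[OF gG])
        ultimately show ?thesis
          by (blast intro: LIMSEQ_le_const2)
      qed
      then show "(SUP f\<in>\<F>. ennreal \<bar>?U f \<omega>\<bar>) = H \<omega>"
        unfolding H_def using G by (intro antisym SUP_least SUP_subset_mono) auto
    qed
  qed
  ultimately show ?thesis by blast
qed

end

end

end

theory Submission
  imports Defs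
begin

text \<open>
  The nodes \<open>n+1, \<dots>, 2n\<close> of the array serve as ghost copies of the nodes \<open>1, \<dots>, n\<close>. Given the first
  \<open>n\<close> nodes and their dyads, the second-order projection at \<open>(i, j)\<close> is the conditional mean of
  \<open>f(Z(i, j)) - f(Z(i, j+n)) - f(Z(i+n, j)) + f(Z(i+n, j+n))\<close>, so Jensen's inequality removes all
  projections. By exchangeability, \<open>i\<close> and \<open>i+n\<close> may be interchanged for all \<open>i\<close> in a set \<open>E\<close>; this
  multiplies the alternating sum by \<open>\<epsilon>(i) \<epsilon>(j)\<close> with the signs \<open>\<epsilon>\<close> belonging to \<open>E\<close>. Averaging over
  \<open>E\<close> therefore leaves four Rademacher chaoses \<open>\<Sum> \<epsilon>(i) \<epsilon>(j) f(z(i, j))\<close>. For fixed data these are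
  bounded by chaining in the empirical \<open>L\<^sub>2\<close> distance: the covering numbers are polynomial, so it
  suffices to control moments of sufficiently high order, which hypercontractivity provides. The
  resulting bound \<open>const * sqrt (\<Sum> F(z(i, j))\<^sup>2)\<close> has expectation of order \<open>n\<close>.
\<close>

section \<open>Moments of Rademacher chaos\<close>

text \<open>The set \<open>E\<close> lists the indices carrying the sign -1. An average over
  independent uniform signs thus becomes a finite sum over \<open>Pow {1..n}\<close>, and one more
  sign corresponds to insertion of \<open>Suc n\<close> into \<open>E\<close>.\<close>

definition rad :: "nat set \<Rightarrow> nat \<Rightarrow> real" where
  "rad E i = (if i \<in> E then -1 else 1)"

definition dyads :: "nat \<Rightarrow> (nat \<times> nat) set" where
  "dyads n = {(i, j). 1 \<le> i \<and> i < j \<and> j \<le> n}"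

definition chaos :: "nat set \<Rightarrow> nat \<Rightarrow> (nat \<times> nat \<Rightarrow> real) \<Rightarrow> real" where
  "chaos E n a = (\<Sum>p\<in>dyads n. rad E (fst p) * rad E (snd p) * a p)"

lemma abs_rad [simp]: "\<bar>rad E i\<bar> = 1"
  by (simp add: rad_def)

lemma dyads_eq_Sigma: "dyads n = (SIGMA i:{1..n}. {i+1..n})"
  by (auto simp: dyads_def)

lemma finite_dyads [simp, intro]: "finite (dyads n)"
  unfolding dyads_eq_Sigma by (intro finite_SigmaI) auto

lemma card_dyads_le: "card (dyads n) \<le> n\<^sup>2"
proof -
  have "card (dyads n) \<le> card ({1..n} \<times> {1..n})"
    by (rule card_mono) (auto simp: dyads_def)
  then show ?thesis by (simp add: power2_eq_square)
qed

lemma sum_dyads_Suc: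
  "(\<Sum>p\<in>dyads (Suc n). h p) = (\<Sum>p\<in>dyads n. h p) + (\<Sum>i=1..n. h (i, Suc n))" for h :: "_ \<Rightarrow> real"
proof -
  have "dyads (Suc n) = dyads n \<union> (\<lambda>i. (i, Suc n)) ` {1..n}"
    by (auto simp: dyads_def)
  moreover have "dyads n \<inter> (\<lambda>i. (i, Suc n)) ` {1..n} = {}"
    by (auto simp: dyads_def)
  ultimately have "(\<Sum>p\<in>dyads (Suc n). h p) = (\<Sum>p\<in>dyads n. h p) + (\<Sum>p\<in>(\<lambda>i. (i, Suc n)) ` {1..n}. h p)"
    by (simp add: sum.union_disjoint)
  also have "(\<Sum>p\<in>(\<lambda>i. (i, Suc n)) ` {1..n}. h p) = (\<Sum>i=1..n. h (i, Suc n))"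
    by (subst sum.reindex) (auto simp: inj_on_def)
  finally show ?thesis .
qed

lemma chaos_add: "chaos E n (\<lambda>p. a p + b p) = chaos E n a + chaos E n b"
  by (simp add: chaos_def algebra_simps sum.distrib)

lemma chaos_zero [simp]: "chaos E n (\<lambda>_. 0) = 0"
  by (simp add: chaos_def)

text \<open>Cauchy-Schwarz against the constant 1 on at most \<open>n\<^sup>2\<close> dyads. The
  bound holds for each single \<open>E\<close>; it handles the remainder at the end of a
  chain.\<close>

lemma abs_chaos_le: "\<bar>chaos E n a\<bar> \<le> n * sqrt (\<Sum>p\<in>dyads n. (a p)\<^sup>2)"
proof -
  have "\<bar>chaos E n a\<bar> \<le> (\<Sum>p\<in>dyads n. \<bar>1::real\<bar> * \<bar>a p\<bar>)"
    unfolding chaos_def by (rule order_trans[OF sum_abs]) (simp add: abs_mult)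
  also have "\<dots> \<le> L2_set (\<lambda>_. 1) (dyads n) * L2_set a (dyads n)"
    by (rule L2_set_mult_ineq)
  also have "L2_set (\<lambda>_. 1::real) (dyads n) = sqrt (card (dyads n))"
    by (simp add: L2_set_def)
  also have "\<dots> \<le> n"
    using card_dyads_le[of n] by (intro real_le_lsqrt) (simp_all flip: of_nat_power)
  finally show ?thesis by (simp add: L2_set_def mult_right_mono sum_nonneg)
qed

text \<open>The optimal constant is \<open>2m - 1\<close>; the crude \<open>4\<^sup>m\<close> comes from \<open>binomial_le_pow2\<close>.\<close>

lemma two_point_moment:
  fixes x y :: real
  shows "(x + y) ^ (2 * m) + (x - y) ^ (2 * m) \<le> 2 * (x\<^sup>2 + 4 ^ m * y\<^sup>2) ^ m"
proof -
  let ?t = "\<lambda>k. of_nat (2 * m choose k) * y ^ k * x ^ (2 * m - k) :: real"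
  have "(x + y) ^ (2 * m) = (\<Sum>k\<le>2 * m. ?t k)"
    by (subst add.commute) (rule binomial_ring)
  moreover have "(x - y) ^ (2 * m) = (\<Sum>k\<le>2 * m. (-1) ^ k * ?t k)"
    using binomial_ring[of "- y" x "2 * m"] 
    by (simp add: power_minus[of y] mult_ac)
  ultimately have "(x + y) ^ (2 * m) + (x - y) ^ (2 * m) = (\<Sum>k\<le>2 * m. (1 + (-1) ^ k) * ?t k)"
    by (simp add: sum.distrib algebra_simps)
  also have "\<dots> = (\<Sum>k\<in>(\<lambda>k. 2 * k) ` {..m}. 2 * ?t k)"
  proof (rule sum.mono_neutral_cong_right)
    show "\<forall>i\<in>{..2 * m} - (\<lambda>k. 2 * k) ` {..m}. (1 + (-1) ^ i) * ?t i = 0"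
    proof
      fix i assume i: "i \<in> {..2 * m} - (\<lambda>k. 2 * k) ` {..m}"
      then have "odd i" by (auto elim!: evenE)
      then show "(1 + (-1) ^ i) * ?t i = 0" by simp
    qed
  qed auto
  also have "\<dots> = (\<Sum>k\<le>m. 2 * ?t (2 * k))"
    by (subst sum.reindex) (auto simp: inj_on_def)
  also have "\<dots> \<le> (\<Sum>k\<le>m. 2 * (of_nat (m choose k) * (4 ^ m * y\<^sup>2) ^ k * (x\<^sup>2) ^ (m - k)))"
  proof (rule sum_mono)
    fix k assume "k \<in> {..m}"
    then have k: "k \<le> m" by simp
    \<comment> \<open>For \<open>k = 0\<close> both sides are 1. For \<open>k > 0\<close> a single
      factor \<open>4 ^ m\<close> already dominates the binomial coefficient, which is where the
      weight of \<open>y\<^sup>2\<close> comes from.\<close>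
    have "(2 * m choose (2 * k)) \<le> (m choose k) * (4 ^ m) ^ k"
    proof (cases "k = 0")
      case False
      have "(2 * m choose (2 * k)) \<le> 2 ^ (2 * m)"
        by (rule binomial_le_pow2)
      also have "\<dots> = 1 * (4 ^ m) ^ 1" by (simp add: power_mult)
      also have "\<dots> \<le> (m choose k) * (4 ^ m) ^ k"
        using False k by (intro mult_mono power_increasing) (auto simp: Suc_le_eq)
      finally show ?thesis .
    qed simp
    then have "real (2 * m choose (2 * k)) \<le> real (m choose k) * (4 ^ m) ^ k"
      unfolding of_nat_le_iff[symmetric, where 'a=real] by simp
    moreover have "0 \<le> y ^ (2 * k) * x ^ (2 * m - 2 * k)"
      using k by (intro mult_nonneg_nonneg zero_le_even_power) auto
    ultimately have "real (2 * m choose (2 * k)) * (y ^ (2 * k) * x ^ (2 * m - 2 * k))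
        \<le> real (m choose k) * (4 ^ m) ^ k * (y ^ (2 * k) * x ^ (2 * m - 2 * k))"
      by (rule mult_right_mono)
    moreover have "x ^ (2 * m - 2 * k) = (x\<^sup>2) ^ (m - k)"
      by (simp add: power_mult[symmetric] diff_mult_distrib2)
    ultimately show "2 * ?t (2 * k) \<le> 2 * (of_nat (m choose k) * (4 ^ m * y\<^sup>2) ^ k * (x\<^sup>2) ^ (m - k))"
      unfolding power_mult[of y] by (simp add: power_mult_distrib mult_ac)
  qed
  also have "\<dots> = 2 * (x\<^sup>2 + 4 ^ m * y\<^sup>2) ^ m"
    by (subst add.commute) (simp add: binomial_ring sum_distrib_left)
  finally show ?thesis .
qed

text \<open>Minkowski's inequality in the space of order \<open>m\<close>, written without roots: up
  to the common factor \<open>c\<close>, the numbers \<alpha> and \<beta> bound the norms of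
  \<open>a\<close> and \<open>b\<close>. It follows from convexity of the \<open>m\<close>-th power,
  applied to the normalised values \<open>a i / \<alpha>\<close> and
  \<open>b i / \<beta>\<close>.\<close>

lemma Minkowski_power:
  fixes a b :: "'a \<Rightarrow> real"
  assumes fin: "finite A" and a0: "\<And>i. i \<in> A \<Longrightarrow> 0 \<le> a i" and b0: "\<And>i. i \<in> A \<Longrightarrow> 0 \<le> b i"
    and \<alpha>: "0 \<le> \<alpha>" and \<beta>: "0 \<le> \<beta>" and m: "0 < m"
    and a: "(\<Sum>i\<in>A. a i ^ m) \<le> c * \<alpha> ^ m" and b: "(\<Sum>i\<in>A. b i ^ m) \<le> c * \<beta> ^ m"
  shows "(\<Sum>i\<in>A. (a i + b i) ^ m) \<le> c * (\<alpha> + \<beta>) ^ m"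
proof (cases "\<alpha> = 0 \<or> \<beta> = 0")
  case True
  have zero: "h i = 0" if "(\<Sum>i\<in>A. h i ^ m) \<le> c * 0 ^ m" "\<And>i. i \<in> A \<Longrightarrow> 0 \<le> h i" "i \<in> A" for h i
  proof -
    have "(\<Sum>i\<in>A. h i ^ m) = 0"
      using that m by (intro antisym sum_nonneg) (auto simp: power_0_left)
    then show ?thesis
      using that fin by (subst (asm) sum_nonneg_eq_0_iff) auto
  qed
  from True show ?thesis
    using zero[of a] zero[of b] a b a0 b0 by auto
next
  case False
  then have pos: "0 < \<alpha>" "0 < \<beta>" using \<alpha> \<beta> by auto
  \<comment> \<open>With these weights the convex combination of \<open>a i / \<alpha>\<close> and
    \<open>b i / \<beta>\<close> is exactly
    \<open>(a i + b i) / (\<alpha> + \<beta>)\<close>.\<close>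
  define \<theta> where "\<theta> = \<beta> / (\<alpha> + \<beta>)"
  have \<theta>: "0 \<le> \<theta>" "\<theta> \<le> 1" and \<theta>': "1 - \<theta> = \<alpha> / (\<alpha> + \<beta>)"
    using pos by (auto simp: \<theta>_def field_simps)
  have conv: "convex_on {0..} (\<lambda>x::real. x ^ m)"
    using convex_power_even[of m] convex_power_odd[of m] convex_on_subset by (cases "even m") auto
  have "(a i + b i) ^ m \<le> (\<alpha> + \<beta>) ^ m * ((1 - \<theta>) * (a i / \<alpha>) ^ m + \<theta> * (b i / \<beta>) ^ m)" if i: "i \<in> A" for i
  proof -
    have "a i + b i = (\<alpha> + \<beta>) * ((1 - \<theta>) * (a i / \<alpha>) + \<theta> * (b i / \<beta>))"
    proof -
      have "(\<alpha> + \<beta>) * (1 - \<theta>) = \<alpha>" "(\<alpha> + \<beta>) * \<theta> = \<beta>"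
        using pos unfolding \<theta>' by (simp_all add: \<theta>_def)
      then show ?thesis using pos by (simp add: distrib_left flip: mult.assoc)
    qed
    then have "(a i + b i) ^ m = (\<alpha> + \<beta>) ^ m * ((1 - \<theta>) * (a i / \<alpha>) + \<theta> * (b i / \<beta>)) ^ m"
      by (simp add: power_mult_distrib)
    also have "((1 - \<theta>) * (a i / \<alpha>) + \<theta> * (b i / \<beta>)) ^ m \<le> (1 - \<theta>) * (a i / \<alpha>) ^ m + \<theta> * (b i / \<beta>) ^ m"
      using convex_onD[OF conv \<theta>, of "a i / \<alpha>" "b i / \<beta>"] a0[OF i] b0[OF i] pos by simp
    finally show ?thesis using pos by (simp add: mult_left_mono)
  qed
  then have "(\<Sum>i\<in>A. (a i + b i) ^ m)
      \<le> (\<Sum>i\<in>A. (\<alpha> + \<beta>) ^ m * ((1 - \<theta>) * (a i / \<alpha>) ^ m + \<theta> * (b i / \<beta>) ^ m))"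
    by (rule sum_mono)
  also have "\<dots> = (\<alpha> + \<beta>) ^ m * ((1 - \<theta>) * ((\<Sum>i\<in>A. a i ^ m) / \<alpha> ^ m) + \<theta> * ((\<Sum>i\<in>A. b i ^ m) / \<beta> ^ m))"
    by (simp only: power_divide sum_divide_distrib sum.distrib flip: sum_distrib_left)
  also have "\<dots> \<le> (\<alpha> + \<beta>) ^ m * ((1 - \<theta>) * c + \<theta> * c)"
    using a b pos \<theta> by (intro mult_left_mono add_mono) (auto simp: field_simps)
  finally show ?thesis by (simp add: algebra_simps)
qed

section \<open>Hypercontractivity by induction on the number of signs\<close>

lemma sum_Pow_Suc:
  "(\<Sum>E\<in>Pow {1..Suc n}. h E) = (\<Sum>E\<in>Pow {1..n}. h E + h (insert (Suc n) E))" for h :: "_ \<Rightarrow> real"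
proof -
  have "Pow {1..Suc n} = Pow {1..n} \<union> insert (Suc n) ` Pow {1..n}"
    by (simp add: atLeastAtMostSuc_conv Pow_insert)
  moreover have "Pow {1..n} \<inter> insert (Suc n) ` Pow {1..n} = {}" by auto
  moreover have "inj_on (insert (Suc n)) (Pow {1..n})"
    by (rule inj_onI) (metis PowD Suc_n_not_le_n atLeastAtMost_iff insert_ident subsetD)
  ultimately show ?thesis
    by (simp add: sum.union_disjoint sum.reindex sum.distrib)
qed

text \<open>As a function of the last sign, \<open>h\<close> is \<open>x\<close> plus or minus
  \<open>y\<close>. Averaging over this sign is the two-point inequality; averaging over the others
  is Minkowski's inequality for the squares, whose norms of order \<open>m\<close> are bounded by
  \<alpha> and \<beta>. Each further sign thus adds its squared norm with the weight
  \<open>4 ^ m\<close>.\<close>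

lemma hypercontractive_step:
  fixes h :: "nat set \<Rightarrow> real"
  assumes m: "0 < m"
    and split: "\<And>E. E \<subseteq> {1..n} \<Longrightarrow> h E = x E + y E" "\<And>E. E \<subseteq> {1..n} \<Longrightarrow> h (insert (Suc n) E) = x E - y E"
    and \<alpha>: "0 \<le> \<alpha>" and \<beta>: "0 \<le> \<beta>"
    and x: "(\<Sum>E\<in>Pow {1..n}. x E ^ (2 * m)) \<le> 2 ^ n * \<alpha> ^ m"
    and y: "(\<Sum>E\<in>Pow {1..n}. y E ^ (2 * m)) \<le> 2 ^ n * \<beta> ^ m"
  shows "(\<Sum>E\<in>Pow {1..Suc n}. h E ^ (2 * m)) \<le> 2 ^ Suc n * (\<alpha> + 4 ^ m * \<beta>) ^ m"
proof -
  have "(\<Sum>E\<in>Pow {1..Suc n}. h E ^ (2 * m)) = (\<Sum>E\<in>Pow {1..n}. (x E + y E) ^ (2 * m) + (x E - y E) ^ (2 * m))"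
    unfolding sum_Pow_Suc using split by (intro sum.cong) auto
  also have "\<dots> \<le> (\<Sum>E\<in>Pow {1..n}. 2 * ((x E)\<^sup>2 + 4 ^ m * (y E)\<^sup>2) ^ m)"
    by (intro sum_mono two_point_moment)
  also have "\<dots> = 2 * (\<Sum>E\<in>Pow {1..n}. ((x E)\<^sup>2 + 4 ^ m * (y E)\<^sup>2) ^ m)"
    by (simp add: sum_distrib_left)
  also have "(\<Sum>E\<in>Pow {1..n}. ((x E)\<^sup>2 + 4 ^ m * (y E)\<^sup>2) ^ m) \<le> 2 ^ n * (\<alpha> + 4 ^ m * \<beta>) ^ m"
  proof (rule Minkowski_power)
    have "(\<Sum>E\<in>Pow {1..n}. (4 ^ m * (y E)\<^sup>2) ^ m) = (4 ^ m) ^ m * (\<Sum>E\<in>Pow {1..n}. y E ^ (2 * m))"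
      by (simp add: sum_distrib_left power_mult_distrib power_mult)
    also have "\<dots> \<le> (4 ^ m) ^ m * (2 ^ n * \<beta> ^ m)"
      using y by (intro mult_left_mono) auto
    finally show "(\<Sum>E\<in>Pow {1..n}. (4 ^ m * (y E)\<^sup>2) ^ m) \<le> 2 ^ n * (4 ^ m * \<beta>) ^ m"
      by (simp add: power_mult_distrib mult_ac)
  qed (use m \<alpha> \<beta> x in \<open>auto simp: power_mult\<close>)
  finally show ?thesis by simp
qed

lemma rad_cong: "E \<subseteq> {1..n} \<Longrightarrow> i \<le> n \<Longrightarrow> rad (insert (Suc n) E) i = rad E i"
  "E \<subseteq> {1..n} \<Longrightarrow> rad E (Suc n) = 1" "rad (insert i E) i = -1"
  by (auto simp: rad_def)

text \<open>In the induction the coefficient of the last sign is the constant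
  \<open>b (Suc n)\<close>, so that every squared coefficient enters with the weight
  \<open>4 ^ m\<close>.\<close>

lemma Khintchine_linear:
  assumes m: "0 < m"
  shows "(\<Sum>E\<in>Pow {1..n}. (\<Sum>i=1..n. rad E i * b i) ^ (2 * m)) \<le> 2 ^ n * (4 ^ m * (\<Sum>i=1..n. (b i)\<^sup>2)) ^ m"
proof (induction n)
  case (Suc n)
  have *: "(\<Sum>i=1..n. rad (insert (Suc n) E) i * b i) = (\<Sum>i=1..n. rad E i * b i)" if "E \<subseteq> {1..n}" for E
    using that by (intro sum.cong) (auto simp: rad_cong)
  have "(\<Sum>E\<in>Pow {1..Suc n}. (\<Sum>i=1..Suc n. rad E i * b i) ^ (2 * m))
      \<le> 2 ^ Suc n * (4 ^ m * (\<Sum>i=1..n. (b i)\<^sup>2) + 4 ^ m * (b (Suc n))\<^sup>2) ^ m"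
  proof (rule hypercontractive_step[OF m _ _ _ _ Suc])
    show "(\<Sum>E\<in>Pow {1..n}. b (Suc n) ^ (2 * m)) \<le> 2 ^ n * ((b (Suc n))\<^sup>2) ^ m"
      by (simp add: card_Pow power_mult)
  qed (use * in \<open>auto simp: rad_cong sum_nonneg\<close>)
  then show ?case by (simp add: algebra_simps)
qed (use m in \<open>simp add: power_0_left\<close>)

lemma chaos_Suc:
  "chaos E (Suc n) a = chaos E n a + rad E (Suc n) * (\<Sum>i=1..n. rad E i * a (i, Suc n))"
  unfolding chaos_def sum_dyads_Suc by (simp add: sum_distrib_left mult_ac)

text \<open>By \<open>chaos_Suc\<close>, the coefficient of the last sign is a linear form in the
  earlier signs. Its moments cost one factor \<open>4 ^ m\<close> by
  \<open>Khintchine_linear\<close>, and the induction step costs another; together they give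
  \<open>16 ^ m\<close>.\<close>

lemma chaos_moment:
  assumes m: "0 < m"
  shows "(\<Sum>E\<in>Pow {1..n}. chaos E n a ^ (2 * m)) \<le> 2 ^ n * (16 ^ m * (\<Sum>p\<in>dyads n. (a p)\<^sup>2)) ^ m"
proof (induction n)
  case 0
  have "dyads 0 = {}" by (auto simp: dyads_def)
  then show ?case using m by (simp add: chaos_def power_0_left)
next
  case (Suc n)
  have *: "chaos (insert (Suc n) E) n a = chaos E n a"
    "(\<Sum>i=1..n. rad (insert (Suc n) E) i * a (i, Suc n)) = (\<Sum>i=1..n. rad E i * a (i, Suc n))"
    if "E \<subseteq> {1..n}" for E
    using that unfolding chaos_def by (auto intro!: sum.cong simp: rad_cong dyads_def)
  have "(\<Sum>E\<in>Pow {1..Suc n}. chaos E (Suc n) a ^ (2 * m))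
      \<le> 2 ^ Suc n * (16 ^ m * (\<Sum>p\<in>dyads n. (a p)\<^sup>2) + 4 ^ m * (4 ^ m * (\<Sum>i=1..n. (a (i, Suc n))\<^sup>2))) ^ m"
    by (rule hypercontractive_step[OF m _ _ _ _ Suc Khintchine_linear[OF m]])
       (use * in \<open>auto simp: chaos_Suc rad_cong sum_nonneg\<close>)
  also have "(4::real) ^ m * (4 ^ m * (\<Sum>i=1..n. (a (i, Suc n))\<^sup>2)) = 16 ^ m * (\<Sum>i=1..n. (a (i, Suc n))\<^sup>2)"
    by (simp flip: mult.assoc power_mult_distrib)
  finally show ?case by (simp add: sum_dyads_Suc algebra_simps)
qed

text \<open>Above the level \<open>t\<close> the ratio of the absolute value to \<open>t\<close>
  exceeds 1 and may be raised to the power \<open>2 * m + 1\<close>. The maximum of a finite family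
  is then at most \<open>t\<close> plus a sum of even powers, to which moment bounds apply.\<close>

lemma abs_le_truncated_power:
  fixes x t :: real
  assumes "0 < t"
  shows "\<bar>x\<bar> \<le> t + x ^ (2 * Suc m) / t ^ (2 * m + 1)"
proof (cases "\<bar>x\<bar> \<le> t")
  case True
  have "0 \<le> x ^ (2 * Suc m) / t ^ (2 * m + 1)"
    using assms by (intro divide_nonneg_pos zero_le_even_power) auto
  then show ?thesis using True by linarith
next
  case False
  then have "\<bar>x\<bar> * t ^ (2 * m + 1) \<le> \<bar>x\<bar> * \<bar>x\<bar> ^ (2 * m + 1)"
    using assms by (intro mult_left_mono power_mono) auto
  also have "\<dots> = \<bar>x\<bar> ^ (2 * Suc m)" by simp
  also have "\<dots> = x ^ (2 * Suc m)" by (rule power_even_abs) simp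
  finally have "\<bar>x\<bar> \<le> x ^ (2 * Suc m) / t ^ (2 * m + 1)"
    using assms by (simp add: field_simps)
  then show ?thesis using assms by linarith
qed

section \<open>Chaining\<close>

lemma square_add_le: "(x + y)\<^sup>2 \<le> 2 * x\<^sup>2 + 2 * y\<^sup>2" for x y :: real
  using zero_le_power2[of "x - y"] by (simp add: power2_eq_square algebra_simps)

text \<open>The large summand bounds, at every level, the number of links times their truncated
  moment, relative to the truncation level. The factor 2 sums the geometric series of truncation
  levels; the final 1 pays for the remainder.\<close>

definition chaining_const :: "real \<Rightarrow> nat \<Rightarrow> real" where
  "chaining_const B w = 2 * (1 + B\<^sup>2 * 4 ^ w * (4 * 16 ^ (2 * w)) ^ (2 * w)) + 1"

text \<open>
  A union bound over the \<open>4^(2kw)\<close> links at level \<open>k\<close> costs less than the gain \<open>4^(-km)\<close> from the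
  moment of order \<open>2m\<close> truncated at \<open>s / 2^k\<close> as soon as \<open>m \<ge> 2w\<close>; the order used is \<open>m = 2w\<close>.
\<close>

lemma chaos_chaining:
  fixes \<A> :: "(nat \<times> nat \<Rightarrow> real) set" and B s :: real
  assumes w: "0 < w" and B: "1 \<le> B" and s: "0 < s"
    and norm: "\<And>a. a \<in> \<A> \<Longrightarrow> (\<Sum>p\<in>dyads n. (a p)\<^sup>2) \<le> s\<^sup>2"
    and cover: "\<And>k. \<exists>C. finite C \<and> card C \<le> B * 4 ^ (k * w) \<and>
      (\<forall>a\<in>\<A>. \<exists>c\<in>C. (\<Sum>p\<in>dyads n. (a p - c p)\<^sup>2) \<le> (s / 4 ^ k)\<^sup>2)"
  shows "\<exists>W. (\<forall>E. 0 \<le> W E \<and> (\<forall>a\<in>\<A>. \<bar>chaos E n a\<bar> \<le> W E)) \<and> (\<Sum>E\<in>Pow {1..n}. W E) \<le> 2 ^ n * (chaining_const B w * s)"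
proof -
  let ?net = "\<lambda>k C. finite C \<and> card C \<le> B * 4 ^ (k * w) \<and>
      (\<forall>a\<in>\<A>. \<exists>c\<in>C. (\<Sum>p\<in>dyads n. (a p - c p)\<^sup>2) \<le> (s / 4 ^ k)\<^sup>2)"
  \<comment> \<open>At level 0 the zero vector alone is a net of radius \<open>s\<close>, by the
    norm hypothesis. With this choice the telescoping sum starts from a vanishing chaos.\<close>
  define C where "C k = (if k = 0 then {\<lambda>_. 0} else SOME C. ?net k C)" for k
  have C0: "C 0 = {\<lambda>_. 0}" by (simp add: C_def)
  have net: "?net k (C k)" for k
  proof (cases "k = 0")
    case True
    show ?thesis unfolding True C0 using norm B by simp
  next
    case False
    then show ?thesis unfolding C_def using someI_ex[OF cover[of k]] by simp
  qed
  have fin: "finite (C k)" and card: "card (C k) \<le> B * 4 ^ (k * w)" for k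
    using net[of k] by blast+
  have near: "\<exists>c\<in>C k. (\<Sum>p\<in>dyads n. (a p - c p)\<^sup>2) \<le> (s / 4 ^ k)\<^sup>2" if "a \<in> \<A>" for k a
    using net[of k] that by blast
  define q where "q k a = (SOME c. c \<in> C k \<and> (\<Sum>p\<in>dyads n. (a p - c p)\<^sup>2) \<le> (s / 4 ^ k)\<^sup>2)" for k a
  have q: "q k a \<in> C k" "(\<Sum>p\<in>dyads n. (a p - q k a p)\<^sup>2) \<le> (s / 4 ^ k)\<^sup>2" if "a \<in> \<A>" for k a
    using someI_ex[OF near[OF that, unfolded Bex_def], of k] unfolding q_def by simp_all
  \<comment> \<open>Only close pairs are kept as links, because the moment of a link is governed by
    its length. The links actually used have length at most \<open>2 * s / 4 ^ k\<close> by the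
    triangle inequality, in the form \<open>square_add_le\<close>.\<close>
  define P where "P k = {(c, c'). c \<in> C k \<and> c' \<in> C (Suc k) \<and> (\<Sum>p\<in>dyads n. (c' p - c p)\<^sup>2) \<le> (2 * s / 4 ^ k)\<^sup>2}" for k
  have P_sub: "P k \<subseteq> C k \<times> C (Suc k)" for k by (auto simp: P_def)
  then have finP: "finite (P k)" for k using fin by (meson finite_SigmaI finite_subset)
  have qP: "(q k a, q (Suc k) a) \<in> P k" if a: "a \<in> \<A>" for k a
  proof -
    have "(\<Sum>p\<in>dyads n. (q (Suc k) a p - q k a p)\<^sup>2)
        \<le> (\<Sum>p\<in>dyads n. 2 * (a p - q k a p)\<^sup>2 + 2 * (a p - q (Suc k) a p)\<^sup>2)"
    proof (rule sum_mono)
      fix p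
      show "(q (Suc k) a p - q k a p)\<^sup>2 \<le> 2 * (a p - q k a p)\<^sup>2 + 2 * (a p - q (Suc k) a p)\<^sup>2"
        using square_add_le[of "a p - q k a p" "q (Suc k) a p - a p"]
        by (simp add: power2_commute[of "a p" "q (Suc k) a p"])
    qed
    also have "\<dots> \<le> 2 * (s / 4 ^ k)\<^sup>2 + 2 * (s / 4 ^ Suc k)\<^sup>2"
      unfolding sum.distrib sum_distrib_left[symmetric] using q(2)[OF a, of k] q(2)[OF a, of "Suc k"]
      by (intro add_mono mult_left_mono) simp_all
    also have "\<dots> \<le> 2 * (s / 4 ^ k)\<^sup>2 + 2 * (s / 4 ^ k)\<^sup>2"
      using s by (intro add_mono mult_left_mono power_mono divide_left_mono) auto
    also have "\<dots> = (2 * s / 4 ^ k)\<^sup>2" by (simp add: power_divide power_mult_distrib)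
    finally show ?thesis using q[OF a] by (auto simp: P_def)
  qed
  \<comment> \<open>The predecessor \<open>m'\<close> of the moment order lets the odd exponent
    \<open>2 * m - 1\<close> be written as \<open>2 * m' + 1\<close>, without subtraction on the
    naturals.\<close>
  obtain m' where m': "2 * w = Suc m'" using w by (cases "2 * w") auto
  define m where "m = Suc m'"
  have m2: "m = 2 * w" using m' by (simp add: m_def)
  \<comment> \<open>The truncation levels are summable in \<open>k\<close>, yet exceed the link
    lengths by a factor growing like \<open>2 ^ k\<close>.\<close>
  define t where "t k = s / 2 ^ k" for k :: nat
  have t: "0 < t k" for k using s by (simp add: t_def)
  define X where "X E (k::nat) cc = chaos E n (\<lambda>p. snd cc p - fst cc p)" for E k and cc :: "(nat \<times> nat \<Rightarrow> real) \<times> (nat \<times> nat \<Rightarrow> real)"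
  \<comment> \<open>Summing over all links in \<open>P k\<close> gives a majorant common to all
    \<open>a\<close>. After \<open>n\<close> levels the chain stops; the summand \<open>s\<close>
    covers what remains.\<close>
  define W where "W E = (\<Sum>k<n. t k + (\<Sum>cc\<in>P k. X E k cc ^ (2 * m) / t k ^ (2 * m' + 1))) + s" for E
  have W0: "0 \<le> W E" for E
    unfolding W_def using s t by (intro add_nonneg_nonneg sum_nonneg divide_nonneg_pos zero_le_even_power) (auto intro: less_imp_le)
  have bound: "\<bar>chaos E n a\<bar> \<le> W E" if a: "a \<in> \<A>" for a E
  proof -
    have tele: "chaos E n (q r a) = (\<Sum>k<r. X E k (q k a, q (Suc k) a))" for r
    proof (induction r)
      case 0
      then show ?case using q(1)[OF a, of 0] C0 by simp
    next
      case (Suc r)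
      then show ?case
        using chaos_add[of E n "q r a" "\<lambda>p. q (Suc r) a p - q r a p"] by (simp add: X_def)
    qed
    have "chaos E n a = chaos E n (q n a) + chaos E n (\<lambda>p. a p - q n a p)"
      using chaos_add[of E n "q n a" "\<lambda>p. a p - q n a p"] by simp
    then have "\<bar>chaos E n a\<bar> \<le> (\<Sum>k<n. \<bar>X E k (q k a, q (Suc k) a)\<bar>) + \<bar>chaos E n (\<lambda>p. a p - q n a p)\<bar>"
      using tele[of n] sum_abs[of "\<lambda>k. X E k (q k a, q (Suc k) a)" "{..<n}"] by linarith
    \<comment> \<open>The crude factor \<open>n\<close> for a single chaos is absorbed by the final
      radius \<open>s / 4 ^ n\<close>.\<close>
    also have "\<bar>chaos E n (\<lambda>p. a p - q n a p)\<bar> \<le> n * (s / 4 ^ n)"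
    proof (rule order_trans[OF abs_chaos_le])
      have "sqrt (\<Sum>p\<in>dyads n. (a p - q n a p)\<^sup>2) \<le> s / 4 ^ n"
        using q(2)[OF a, of n] s by (intro real_le_lsqrt) auto
      then show "n * sqrt (\<Sum>p\<in>dyads n. (a p - q n a p)\<^sup>2) \<le> n * (s / 4 ^ n)"
        by (intro mult_left_mono) auto
    qed
    also have "n * (s / 4 ^ n) \<le> s"
    proof -
      have "real n \<le> 4 ^ n"
      proof -
        have "n < 4 ^ n" by (rule power_gt_expt) simp
        then show ?thesis by (simp add: of_nat_le_numeral_power_cancel_iff)
      qed
      then show ?thesis using s by (simp add: pos_divide_le_eq mult.commute)
    qed
    also have "(\<Sum>k<n. \<bar>X E k (q k a, q (Suc k) a)\<bar>) \<le> (\<Sum>k<n. t k + (\<Sum>cc\<in>P k. X E k cc ^ (2 * m) / t k ^ (2 * m' + 1)))"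
    proof (rule sum_mono)
      fix k
      have "\<bar>X E k (q k a, q (Suc k) a)\<bar> \<le> t k + X E k (q k a, q (Suc k) a) ^ (2 * m) / t k ^ (2 * m' + 1)"
        unfolding m_def by (rule abs_le_truncated_power[OF t])
      also have "X E k (q k a, q (Suc k) a) ^ (2 * m) / t k ^ (2 * m' + 1) \<le> (\<Sum>cc\<in>P k. X E k cc ^ (2 * m) / t k ^ (2 * m' + 1))"
        using t[of k] by (intro member_le_sum[OF qP[OF a]] finP divide_nonneg_pos zero_le_even_power) auto
      finally show "\<bar>X E k (q k a, q (Suc k) a)\<bar> \<le> t k + (\<Sum>cc\<in>P k. X E k cc ^ (2 * m) / t k ^ (2 * m' + 1))"
        by simp
    qed
    finally show ?thesis by (simp add: W_def)
  qed
  define D where "D = B\<^sup>2 * 4 ^ w * (4 * 16 ^ m) ^ m"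
  have D: "0 \<le> D" using B by (simp add: D_def)
  have level: "(\<Sum>E\<in>Pow {1..n}. t k + (\<Sum>cc\<in>P k. X E k cc ^ (2 * m) / t k ^ (2 * m' + 1))) \<le> 2 ^ n * ((1 + D) * s * (1 / 2) ^ k)" for k
  proof -
    have X: "(\<Sum>E\<in>Pow {1..n}. X E k cc ^ (2 * m)) \<le> 2 ^ n * (16 ^ m * (2 * s / 4 ^ k)\<^sup>2) ^ m" if "cc \<in> P k" for cc
    proof -
      have "(\<Sum>E\<in>Pow {1..n}. X E k cc ^ (2 * m)) \<le> 2 ^ n * (16 ^ m * (\<Sum>p\<in>dyads n. (snd cc p - fst cc p)\<^sup>2)) ^ m"
        unfolding X_def by (rule chaos_moment) (simp add: m_def)
      also have "\<dots> \<le> 2 ^ n * (16 ^ m * (2 * s / 4 ^ k)\<^sup>2) ^ m"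
        using that by (intro mult_left_mono power_mono mult_nonneg_nonneg sum_nonneg) (auto simp: P_def)
      finally show ?thesis .
    qed
    have cP: "card (P k) \<le> B\<^sup>2 * 4 ^ w * 4 ^ (2 * k * w)"
    proof -
      have "real (card (P k)) \<le> real (card (C k \<times> C (Suc k)))"
        using card_mono[OF _ P_sub[of k]] fin by (intro of_nat_mono) simp
      also have "\<dots> = real (card (C k)) * real (card (C (Suc k)))" by (simp add: card_cartesian_product)
      also have "\<dots> \<le> (B * 4 ^ (k * w)) * (B * 4 ^ (Suc k * w))"
        using B by (intro mult_mono card) auto
      also have "\<dots> = B\<^sup>2 * 4 ^ w * 4 ^ (2 * k * w)"
      proof -
        have "(4::real) ^ (Suc k * w) = 4 ^ w * 4 ^ (k * w)" by (simp add: power_add)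
        moreover have "(4::real) ^ (2 * k * w) = 4 ^ (k * w) * 4 ^ (k * w)"
          by (simp only: mult_2 distrib_right power_add)
        ultimately show ?thesis by (simp only: power2_eq_square mult_ac)
      qed
      finally show ?thesis .
    qed
    have "(\<Sum>E\<in>Pow {1..n}. t k + (\<Sum>cc\<in>P k. X E k cc ^ (2 * m) / t k ^ (2 * m' + 1)))
        = 2 ^ n * t k + (\<Sum>cc\<in>P k. \<Sum>E\<in>Pow {1..n}. X E k cc ^ (2 * m)) / t k ^ (2 * m' + 1)"
      unfolding sum.distrib sum_divide_distrib by (subst (2) sum.swap) (simp add: card_Pow)
    also have "\<dots> \<le> 2 ^ n * t k + (\<Sum>cc\<in>P k. 2 ^ n * (16 ^ m * (2 * s / 4 ^ k)\<^sup>2) ^ m) / t k ^ (2 * m' + 1)"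
      using t[of k] X by (intro add_left_mono divide_right_mono sum_mono) auto
    also have "\<dots> = 2 ^ n * (t k + card (P k) * ((16 ^ m * (2 * s / 4 ^ k)\<^sup>2) ^ m / t k ^ (2 * m' + 1)))"
      by (simp add: algebra_simps)
    also have "(16 ^ m * (2 * s / 4 ^ k)\<^sup>2) ^ m / t k ^ (2 * m' + 1) = (4 * 16 ^ m) ^ m * t k / 4 ^ (k * m)"
    proof -
      \<comment> \<open>Expressing the link length through \<open>t k\<close> isolates the gain: the
        \<open>m\<close>-th power of \<open>1 / 4 ^ k\<close> survives, and after division by the
        odd power one factor \<open>t k\<close> is left.\<close>
      have "(2 * s / 4 ^ k)\<^sup>2 = 4 * (t k)\<^sup>2 / 4 ^ k"
      proof -
        have "(4::real) ^ k = 2 ^ k * 2 ^ k" by (simp flip: power_mult_distrib)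
        then show ?thesis using s by (simp add: t_def power2_eq_square field_simps)
      qed
      moreover have "((t k)\<^sup>2) ^ m = (t k ^ m)\<^sup>2"
        by (simp add: mult.commute flip: power_mult)
      ultimately have "(16 ^ m * (2 * s / 4 ^ k)\<^sup>2) ^ m = (4 * 16 ^ m) ^ m * t k ^ (2 * m) / 4 ^ (k * m)"
        by (simp add: power_mult[of "t k"] power_mult[of _ k] power_mult_distrib power_divide mult_ac)
      moreover have "t k ^ (2 * m) = t k * t k ^ (2 * m' + 1)" by (simp add: m_def)
      ultimately show ?thesis using t[of k] by simp
    qed
    also have "card (P k) * ((4 * 16 ^ m) ^ m * t k / 4 ^ (k * m)) \<le> (B\<^sup>2 * 4 ^ w * 4 ^ (2 * k * w)) * ((4 * 16 ^ m) ^ m * t k / 4 ^ (k * m))"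
      using t[of k] by (intro mult_right_mono cP) auto
    \<comment> \<open>The choice \<open>m = 2 * w\<close> makes the growth of the number of links
      cancel the gain exactly.\<close>
    also have "(4::real) ^ (2 * k * w) = 4 ^ (k * m)"
      by (simp add: m2 mult_ac)
    also have "2 ^ n * (t k + B\<^sup>2 * 4 ^ w * 4 ^ (k * m) * ((4 * 16 ^ m) ^ m * t k / 4 ^ (k * m))) = 2 ^ n * ((1 + D) * t k)"
      by (simp add: D_def distrib_right)
    finally show ?thesis
      by (simp add: t_def power_divide mult_ac mult_left_mono)
  qed
  have "(\<Sum>E\<in>Pow {1..n}. W E) = (\<Sum>k<n. \<Sum>E\<in>Pow {1..n}. t k + (\<Sum>cc\<in>P k. X E k cc ^ (2 * m) / t k ^ (2 * m' + 1))) + 2 ^ n * s"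
    unfolding W_def by (subst sum.swap) (simp add: sum.distrib card_Pow)
  also have "\<dots> \<le> (\<Sum>k<n. 2 ^ n * ((1 + D) * s * (1 / 2) ^ k)) + 2 ^ n * s"
    by (intro add_right_mono sum_mono level)
  also have "\<dots> = 2 ^ n * ((1 + D) * s * (\<Sum>k<n. (1 / 2) ^ k) + s)"
    by (simp add: sum_distrib_left algebra_simps)
  also have "(\<Sum>k<n. (1 / 2) ^ k) \<le> (2::real)"
    by (subst sum_gp_strict) auto
  finally have "(\<Sum>E\<in>Pow {1..n}. W E) \<le> 2 ^ n * ((1 + D) * s * 2 + s)"
    using D s by (auto simp: mult_left_mono)
  also have "(1 + D) * s * 2 + s = chaining_const B w * s"
    by (simp add: D_def chaining_const_def m2 algebra_simps)
  finally show ?thesis using bound W0 by blast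
qed

section \<open>Classes of VC type\<close>

text \<open>
  The exponent in the definition of \<open>VC_type\<close> may be negative, and the covering bound may be smaller
  than 1; both are normalised here.
\<close>

lemma VC_type_cover:
  assumes VC: "VC_type Z \<F> F"
  obtains B :: real and w :: nat where "1 \<le> B" "0 < w"
    "\<And>Q \<epsilon>. prob_space Q \<Longrightarrow> sets Q = sets Z \<Longrightarrow> integrable Q (\<lambda>z. (F z)\<^sup>2) \<Longrightarrow> 0 < L2_seminorm Q F \<Longrightarrow>
      0 < \<epsilon> \<Longrightarrow> \<epsilon> \<le> 1 \<Longrightarrow> \<exists>C. finite C \<and> card C \<le> B * (1 / \<epsilon>) ^ w \<and> C \<subseteq> borel_measurable Q \<and>
        (\<forall>f\<in>\<F>. \<exists>g\<in>C. L2_seminorm Q (\<lambda>z. f z - g z) < \<epsilon> * L2_seminorm Q F)"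
proof -
  obtain A v where A: "0 < A"
    and sup: "\<And>\<epsilon>. 0 < \<epsilon> \<Longrightarrow> \<epsilon> \<le> 1 \<Longrightarrow>
        (SUP Q \<in> {Q. prob_space Q \<and> sets Q = sets Z \<and> integrable Q (\<lambda>z. (F z)\<^sup>2) \<and> 0 < L2_seminorm Q F}.
           ennreal_of_enat (covering_number (\<epsilon> * L2_seminorm Q F) \<F> Q)) \<le> ennreal ((A / \<epsilon>) powr v)"
    using VC unfolding VC_type_def by (elim conjE exE) (rule that; blast)
  \<comment> \<open>Since \<open>1 / \<epsilon>\<close> is at least 1, raising the exponent from
    \<open>v\<close> to a positive integer only weakens the bound; the maximum with 1 likewise
    enlarges the constant.\<close>
  define B where "B = max 1 (A powr v)"
  define w where "w = Suc (nat \<lceil>v\<rceil>)"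
  show thesis
  proof
    show "1 \<le> B" "0 < w" by (auto simp: B_def w_def)
    fix Q and \<epsilon> :: real
    assume Q: "prob_space Q" "sets Q = sets Z" "integrable Q (\<lambda>z. (F z)\<^sup>2)" "0 < L2_seminorm Q F"
      and \<epsilon>: "0 < \<epsilon>" "\<epsilon> \<le> 1"
    have bound: "(A / \<epsilon>) powr v \<le> B * (1 / \<epsilon>) ^ w"
    proof -
      have "(A / \<epsilon>) powr v = A powr v * (1 / \<epsilon>) powr v"
        using A \<epsilon> by (simp add: powr_mult[symmetric])
      also have "(1 / \<epsilon>) powr v \<le> (1 / \<epsilon>) powr w"
        using \<epsilon> by (intro powr_mono) (auto simp: w_def, linarith)
      also have "(1 / \<epsilon>) powr w = (1 / \<epsilon>) ^ w"
        using \<epsilon> by (intro powr_realpow) auto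
      finally have "(A / \<epsilon>) powr v \<le> A powr v * (1 / \<epsilon>) ^ w" by (simp add: mult_left_mono)
      also have "\<dots> \<le> B * (1 / \<epsilon>) ^ w"
        using \<epsilon> by (intro mult_right_mono) (auto simp: B_def)
      finally show ?thesis .
    qed
    let ?S = "{enat (card C) |C. finite C \<and>
     (\<forall>g\<in>C. g \<in> borel_measurable Q \<and> integrable Q (\<lambda>z. (g z)\<^sup>2)) \<and>
     (\<forall>f\<in>\<F>. \<exists>g\<in>C. L2_seminorm Q (\<lambda>z. f z - g z) < \<epsilon> * L2_seminorm Q F)}"
    have cn: "covering_number (\<epsilon> * L2_seminorm Q F) \<F> Q = Inf ?S"
      by (simp add: covering_number_def)
    have le: "ennreal_of_enat (Inf ?S) \<le> ennreal ((A / \<epsilon>) powr v)"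
      unfolding cn[symmetric] using Q by (intro order_trans[OF SUP_upper sup[OF \<epsilon>]]) simp
    \<comment> \<open>The infimum of the empty set is infinite in \<open>enat\<close>, which the
      finite covering bound excludes. A nonempty set of extended naturals attains its infimum, so an
      optimal cover exists.\<close>
    have "?S \<noteq> {}"
    proof
      assume "?S = {}"
      then have "Inf ?S = \<infinity>" by (simp add: Inf_enat_def)
      with le show False by (simp add: top_unique)
    qed
    then have "Inf ?S \<in> ?S"
      by (rule wellorder_InfI[OF ex_in_conv[THEN iffD2, THEN someI_ex]])
    then obtain C where C: "finite C" "\<forall>g\<in>C. g \<in> borel_measurable Q \<and> integrable Q (\<lambda>z. (g z)\<^sup>2)"
      "\<forall>f\<in>\<F>. \<exists>g\<in>C. L2_seminorm Q (\<lambda>z. f z - g z) < \<epsilon> * L2_seminorm Q F"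
      and card: "Inf ?S = enat (card C)" by blast
    from le have "ennreal (real (card C)) \<le> ennreal ((A / \<epsilon>) powr v)"
      unfolding card by (simp add: ennreal_of_nat_eq_real_of_nat)
    then have "real (card C) \<le> (A / \<epsilon>) powr v"
      by (simp add: ennreal_le_iff)
    then show "\<exists>C. finite C \<and> card C \<le> B * (1 / \<epsilon>) ^ w \<and> C \<subseteq> borel_measurable Q \<and>
        (\<forall>f\<in>\<F>. \<exists>g\<in>C. L2_seminorm Q (\<lambda>z. f z - g z) < \<epsilon> * L2_seminorm Q F)"
      using C bound by (intro exI[of _ C]) auto
  qed
qed

text \<open>Pushing the uniform measure on the index set forward along \<open>z\<close> counts
  repeated values with their multiplicity. The entropy hypothesis can therefore be evaluated at the
  data points themselves.\<close>

lemma empirical_measure: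
  assumes P: "finite P" "P \<noteq> {}" and z: "z ` P \<subseteq> space Z"
  defines "Q \<equiv> distr (uniform_count_measure P) Z z"
  shows "prob_space Q"
    and "h \<in> borel_measurable Z \<Longrightarrow> integrable Q (\<lambda>x. (h x)\<^sup>2)"
    and "h \<in> borel_measurable Z \<Longrightarrow> L2_seminorm Q h = sqrt ((\<Sum>p\<in>P. (h (z p))\<^sup>2) / card P)"
proof -
  have m: "z \<in> measurable (uniform_count_measure P) Z"
    unfolding uniform_count_measure_def using z by auto
  interpret prob_space "uniform_count_measure P"
    using P by (rule prob_space_uniform_count_measure)
  show "prob_space Q"
    unfolding Q_def by (rule prob_space_distr[OF m])
  assume h: "h \<in> borel_measurable Z"
  show "integrable Q (\<lambda>x. (h x)\<^sup>2)"
    unfolding Q_def using P h m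
    by (subst integrable_distr_eq) (auto simp: uniform_count_measure_def integrable_point_measure_finite)
  have "(\<integral>x. (h x)\<^sup>2 \<partial>Q) = (\<Sum>p\<in>P. (h (z p))\<^sup>2) / card P"
    unfolding Q_def using P h m
    by (subst integral_distr)
       (auto simp: uniform_count_measure_def lebesgue_integral_point_measure_finite sum_divide_distrib)
  then show "L2_seminorm Q h = sqrt ((\<Sum>p\<in>P. (h (z p))\<^sup>2) / card P)"
    by (simp add: L2_seminorm_def)
qed

text \<open>Chaining is applied to the vectors of values of the functions at the data, with nets
  taken from covers in the empirical norm. The covering bound is uniform over probability measures,
  so one \<open>L\<close> serves all sample sizes and all data.\<close>

lemma VC_type_chaos_bound:
  assumes VC: "VC_type Z \<F> F" and F: "F \<in> borel_measurable Z" and \<F>: "\<F> \<subseteq> borel_measurable Z"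
  obtains L where "0 \<le> L"
    "\<And>n z. z ` dyads n \<subseteq> space Z \<Longrightarrow>
      \<exists>W. (\<forall>E. 0 \<le> W E \<and> (\<forall>f\<in>\<F>. \<bar>chaos E n (\<lambda>p. f (z p))\<bar> \<le> W E)) \<and>
        (\<Sum>E\<in>Pow {1..n}. W E) \<le> 2 ^ n * (L * sqrt (\<Sum>p\<in>dyads n. (F (z p))\<^sup>2))"
proof (rule VC_type_cover[OF VC])
  fix B :: real and w :: nat
  assume B: "1 \<le> B" "0 < w"
    and cover: "\<And>Q \<epsilon>. prob_space Q \<Longrightarrow> sets Q = sets Z \<Longrightarrow> integrable Q (\<lambda>z. (F z)\<^sup>2) \<Longrightarrow> 0 < L2_seminorm Q F \<Longrightarrow>
      0 < \<epsilon> \<Longrightarrow> \<epsilon> \<le> 1 \<Longrightarrow> \<exists>C. finite C \<and> card C \<le> B * (1 / \<epsilon>) ^ w \<and> C \<subseteq> borel_measurable Q \<and>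
        (\<forall>f\<in>\<F>. \<exists>g\<in>C. L2_seminorm Q (\<lambda>z. f z - g z) < \<epsilon> * L2_seminorm Q F)"
  have env: "\<bar>f z\<bar> \<le> F z" if "f \<in> \<F>" "z \<in> space Z" for f z
    using VC that by (auto simp: VC_type_def)
  show thesis
  proof
    show "0 \<le> chaining_const B w" using B by (simp add: chaining_const_def)
    fix n and z :: "nat \<times> nat \<Rightarrow> 'a" assume z: "z ` dyads n \<subseteq> space Z"
    define s where "s = sqrt (\<Sum>p\<in>dyads n. (F (z p))\<^sup>2)"
    have s2: "s\<^sup>2 = (\<Sum>p\<in>dyads n. (F (z p))\<^sup>2)" by (simp add: s_def sum_nonneg)
    have sq: "(f (z p))\<^sup>2 \<le> (F (z p))\<^sup>2" if "f \<in> \<F>" "p \<in> dyads n" for f p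
      using env[OF that(1), of "z p"] that z by (intro abs_le_square_iff[THEN iffD1]) force
    show "\<exists>W. (\<forall>E. 0 \<le> W E \<and> (\<forall>f\<in>\<F>. \<bar>chaos E n (\<lambda>p. f (z p))\<bar> \<le> W E)) \<and>
        (\<Sum>E\<in>Pow {1..n}. W E) \<le> 2 ^ n * (chaining_const B w * sqrt (\<Sum>p\<in>dyads n. (F (z p))\<^sup>2))"
    \<comment> \<open>A zero envelope norm is outside the scope of the covering hypothesis, but then
      all functions of the class vanish at the data and \<open>W\<close> can be zero.\<close>
    proof (cases "s = 0")
      case True
      then have "F (z p) = 0" if "p \<in> dyads n" for p
        using that by (auto simp: s_def sum_nonneg_eq_0_iff)
      with sq have "f (z p) = 0" if "f \<in> \<F>" "p \<in> dyads n" for f p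
        using that by fastforce
      then have "chaos E n (\<lambda>p. f (z p)) = 0" if "f \<in> \<F>" for E f
        using that by (auto simp: chaos_def intro!: sum.neutral)
      then show ?thesis using True by (intro exI[of _ "\<lambda>_. 0"]) (simp add: s_def)
    next
      case False
      then have s: "0 < s" using sum_nonneg[of "dyads n" "\<lambda>p. (F (z p))\<^sup>2"] by (auto simp: s_def less_le)
      have ne: "dyads n \<noteq> {}" using False by (auto simp: s_def)
      define Q where "Q = distr (uniform_count_measure (dyads n)) Z z"
      note emp = empirical_measure[OF finite_dyads ne z, folded Q_def]
      have "\<exists>W. (\<forall>E. 0 \<le> W E \<and> (\<forall>a\<in>(\<lambda>f p. f (z p)) ` \<F>. \<bar>chaos E n a\<bar> \<le> W E)) \<and>
          (\<Sum>E\<in>Pow {1..n}. W E) \<le> 2 ^ n * (chaining_const B w * s)"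
      proof (rule chaos_chaining[OF B(2,1) s])
        show "(\<Sum>p\<in>dyads n. (a p)\<^sup>2) \<le> s\<^sup>2" if "a \<in> (\<lambda>f p. f (z p)) ` \<F>" for a
          using that sq unfolding s2 by (auto intro!: sum_mono)
        fix k :: nat
        have c: "0 < real (card (dyads n))" using ne by (simp add: card_gt_0_iff)
        \<comment> \<open>The normalisation by the square root of the number of dyads appears in
          this norm and in the distances alike, and cancels below.\<close>
        have normF: "L2_seminorm Q F = s / sqrt (card (dyads n))"
          unfolding emp(3)[OF F] by (simp add: s_def real_sqrt_divide)
        obtain C where C: "finite C" "card C \<le> B * (1 / (1 / 4 ^ k)) ^ w" "C \<subseteq> borel_measurable Q"
          "\<forall>f\<in>\<F>. \<exists>g\<in>C. L2_seminorm Q (\<lambda>x. f x - g x) < 1 / 4 ^ k * L2_seminorm Q F"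
          using cover[of Q "1 / 4 ^ k"] emp(1) emp(2)[OF F] s c unfolding normF by (auto simp: Q_def)
        show "\<exists>C. finite C \<and> card C \<le> B * 4 ^ (k * w) \<and>
          (\<forall>a\<in>(\<lambda>f p. f (z p)) ` \<F>. \<exists>c\<in>C. (\<Sum>p\<in>dyads n. (a p - c p)\<^sup>2) \<le> (s / 4 ^ k)\<^sup>2)"
        proof (intro exI[of _ "(\<lambda>g p. g (z p)) ` C"] conjI)
          show "finite ((\<lambda>g p. g (z p)) ` C)" using C by simp
          have "real (card ((\<lambda>g p. g (z p)) ` C)) \<le> card C" using C by (simp add: card_image_le)
          also have "\<dots> \<le> B * 4 ^ (k * w)" using C by (simp add: power_mult)
          finally show "card ((\<lambda>g p. g (z p)) ` C) \<le> B * 4 ^ (k * w)" .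
          have "\<exists>g\<in>C. (\<Sum>p\<in>dyads n. (f (z p) - g (z p))\<^sup>2) \<le> (s / 4 ^ k)\<^sup>2" if f: "f \<in> \<F>" for f
          proof -
            obtain g where g: "g \<in> C" "L2_seminorm Q (\<lambda>x. f x - g x) < 1 / 4 ^ k * L2_seminorm Q F"
              using C f by blast
            have "g \<in> borel_measurable Q" using g C by auto
            then have "g \<in> borel_measurable Z" by (simp add: Q_def)
            with f \<F> have "(\<lambda>x. f x - g x) \<in> borel_measurable Z" by auto
            from g(2)[unfolded emp(3)[OF this] normF]
            have "sqrt (\<Sum>p\<in>dyads n. (f (z p) - g (z p))\<^sup>2) / sqrt (card (dyads n))
                < s / 4 ^ k / sqrt (card (dyads n))"
              by (simp add: real_sqrt_divide)
            then have "sqrt (\<Sum>p\<in>dyads n. (f (z p) - g (z p))\<^sup>2) < s / 4 ^ k"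
              using c unfolding divide_less_cancel by auto
            then have "sqrt (\<Sum>p\<in>dyads n. (f (z p) - g (z p))\<^sup>2) \<le> s / 4 ^ k"
              by (rule less_imp_le)
            then have "(\<Sum>p\<in>dyads n. (f (z p) - g (z p))\<^sup>2) \<le> (s / 4 ^ k)\<^sup>2"
              by (rule sqrt_le_D)
            with g(1) show ?thesis by blast
          qed
          then show "\<forall>a\<in>(\<lambda>f p. f (z p)) ` \<F>. \<exists>c\<in>(\<lambda>g p. g (z p)) ` C.
              (\<Sum>p\<in>dyads n. (a p - c p)\<^sup>2) \<le> (s / 4 ^ k)\<^sup>2"
            by auto
        qed
      qed
      then show ?thesis by (simp add: s_def)
    qed
  qed
qed

section \<open>Ghost nodes and exchangeability\<close>

definition ghost :: "nat \<Rightarrow> (nat \<Rightarrow> nat \<Rightarrow> real) \<Rightarrow> nat \<times> nat \<Rightarrow> real" where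
  "ghost n h p = h (fst p) (snd p) - h (fst p) (snd p + n) - h (fst p + n) (snd p) + h (fst p + n) (snd p + n)"

text \<open>Given as a map on all naturals, so that for \<open>E\<close> inside
  \<open>{1..n}\<close> it is an involution and hence injective, as \<open>exchangeable\<close>
  requires.\<close>

definition swap :: "nat set \<Rightarrow> nat \<Rightarrow> nat \<Rightarrow> nat" where
  "swap E n k = (if k \<in> E then k + n else if n < k \<and> k - n \<in> E then k - n else k)"

lemma swap_swap: "E \<subseteq> {1..n} \<Longrightarrow> swap E n (swap E n k) = k"
  unfolding swap_def by (auto simp: subset_eq)

lemma swap_range: "E \<subseteq> {1..n} \<Longrightarrow> 1 \<le> k \<Longrightarrow> 1 \<le> swap E n k"
  unfolding swap_def by (auto simp: subset_eq)

lemma inj_swap: "E \<subseteq> {1..n} \<Longrightarrow> inj (swap E n)"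
  by (metis injI swap_swap)

text \<open>Interchanging one of the two nodes with its ghost permutes the four terms in pairs of
  opposite sign. Each endpoint in \<open>E\<close> thus contributes a factor -1.\<close>

lemma ghost_swap:
  assumes E: "E \<subseteq> {1..n}" and p: "p \<in> dyads n"
  shows "ghost n (\<lambda>k l. h (swap E n k) (swap E n l)) p = rad E (fst p) * rad E (snd p) * ghost n h p"
proof -
  have "swap E n i = (if i \<in> E then i + n else i)" "swap E n (i + n) = (if i \<in> E then i else i + n)"
    if "1 \<le> i" "i \<le> n" for i
    using E that by (auto simp: swap_def)
  then show ?thesis using p by (auto simp: ghost_def dyads_def rad_def)
qed

text \<open>Intersections and products over a finite part of the index set are carried over by the
  inverse of \<open>h\<close> on it. This is what allows the variables to be renamed in
  \<open>array_law\<close>.\<close>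

lemma (in prob_space) indep_sets_reindex:
  assumes inj: "inj_on h K" and ind: "indep_sets F (h ` K)"
  shows "indep_sets (\<lambda>k. F (h k)) K"
proof (rule indep_setsI)
  show "F (h k) \<subseteq> events" if "k \<in> K" for k
    using ind that by (auto simp: indep_sets_def)
  fix A J assume J: "J \<noteq> {}" "J \<subseteq> K" "finite J" "\<forall>j\<in>J. A j \<in> F (h j)"
  have injJ: "inj_on h J" using inj J(2) by (rule inj_on_subset)
  have inv: "the_inv_into J h (h j) = j" if "j \<in> J" for j
    using injJ that by (rule the_inv_into_f_f)
  have "prob (\<Inter>i\<in>h ` J. A (the_inv_into J h i)) = (\<Prod>i\<in>h ` J. prob (A (the_inv_into J h i)))"
    using J inv by (intro indep_setsD[OF ind]) auto
  then show "prob (\<Inter>j\<in>J. A j) = (\<Prod>j\<in>J. prob (A j))"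
    using injJ inv by (simp add: prod.reindex)
qed

lemma Int_stable_vimage: "Int_stable {X -` A \<inter> \<Omega> |A. A \<in> sets N}"
proof (rule Int_stableI, clarify)
  fix A B assume "A \<in> sets N" "B \<in> sets N"
  then show "\<exists>C. X -` A \<inter> \<Omega> \<inter> (X -` B \<inter> \<Omega>) = X -` C \<inter> \<Omega> \<and> C \<in> sets N"
    by (intro exI[of _ "A \<inter> B"]) auto
qed

context dyadic_array
begin

context
  notes One_nat_def [simp del]
begin

section \<open>Independence of disjoint blocks of variables\<close>

definition gen :: "nat + nat \<times> nat \<Rightarrow> 'w set set" where
  "gen = case_sum (\<lambda>i. {U i -` A \<inter> space M |A. A \<in> sets S})
                  (\<lambda>(i, j). {V i j -` A \<inter> space M |A. A \<in> sets T})"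

definition indices :: "(nat + nat \<times> nat) set" where
  "indices = {Inl i |i. 1 \<le> i} \<union> {Inr (i, j) |i j. 1 \<le> i \<and> i < j}"

text \<open>Only the sigma-algebra of this measure space matters: measurability from
  \<open>block I\<close> encodes dependence on the variables indexed by \<open>I\<close>
  alone.\<close>

definition block :: "(nat + nat \<times> nat) set \<Rightarrow> 'w measure" where
  "block I = sigma (space M) (\<Union>x\<in>I. gen x)"

abbreviation "dyad_law \<equiv> distr M T (V 1 2)"
abbreviation "Z \<equiv> dyad_obs U V \<tau>"

lemma indep_gen: "indep_sets gen indices"
  using independent by (simp add: gen_def indices_def)

lemma gen_sub: "gen x \<subseteq> Pow (space M)"
  by (cases x) (auto simp: gen_def)

lemma sets_block: "sets (block I) = sigma_sets (space M) (\<Union>x\<in>I. gen x)"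
  and space_block [simp]: "space (block I) = space M"
  unfolding block_def using gen_sub by (auto intro!: sets_measure_of space_measure_of)

lemma Int_stable_gen: "Int_stable (gen x)"
  by (cases x) (auto simp: gen_def Int_stable_vimage split: prod.splits)

lemma U_block: "Inl i \<in> I \<Longrightarrow> 1 \<le> i \<Longrightarrow> U i \<in> measurable (block I) S"
  using measurable_space[OF node_measurable, of i]
  by (intro measurableI) (auto simp: sets_block gen_def intro!: sigma_sets.Basic bexI[of _ "Inl i"] exI)

lemma V_block: "Inr (i, j) \<in> I \<Longrightarrow> 1 \<le> i \<Longrightarrow> i < j \<Longrightarrow> V i j \<in> measurable (block I) T"
  using measurable_space[OF dyad_measurable, of i j]
  by (intro measurableI) (auto simp: sets_block gen_def intro!: sigma_sets.Basic bexI[of _ "Inr (i, j)"] exI)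

text \<open>The block sigma-algebra is coarser than that of \<open>M\<close>. Phrasing this as
  measurability of the identity makes the restriction of \<open>M\<close> to a block available as an
  image measure.\<close>

lemma id_block:
  assumes "I \<subseteq> indices"
  shows "(\<lambda>\<omega>. \<omega>) \<in> measurable M (block I)"
proof (rule measurable_sigma_sets[OF sets_block])
  show "(\<Union>x\<in>I. gen x) \<subseteq> Pow (space M)" using gen_sub by blast
  fix A assume "A \<in> (\<Union>x\<in>I. gen x)"
  then obtain x where "x \<in> I" "A \<in> gen x" by blast
  with assms indep_gen have "A \<in> events" by (auto simp: indep_sets_def)
  then show "(\<lambda>\<omega>. \<omega>) -` A \<inter> space M \<in> events" by simp
qed simp

lemma block_measurable:
  assumes "I \<subseteq> indices" "X \<in> measurable (block I) N"
  shows "X \<in> measurable M N"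
  by (rule measurable_compose[OF id_block assms(2)]) fact

text \<open>Independent families closed under intersection may be grouped: disjoint blocks generate
  independent sigma-algebras. The product formula then needs checking on rectangles only.\<close>

lemma indep_blocks:
  assumes I: "I \<subseteq> indices" and J: "J \<subseteq> indices" and disj: "I \<inter> J = {}"
    and X: "X \<in> measurable (block I) N" and Y: "Y \<in> measurable (block J) N'"
  shows "distr M (N \<Otimes>\<^sub>M N') (\<lambda>\<omega>. (X \<omega>, Y \<omega>)) = distr M N X \<Otimes>\<^sub>M distr M N' Y"
proof -
  have [measurable]: "X \<in> measurable M N" "Y \<in> measurable M N'"
    using block_measurable I J X Y by blast+
  interpret X: prob_space "distr M N X" by (rule prob_space_distr) measurable
  interpret Y: prob_space "distr M N' Y" by (rule prob_space_distr) measurable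
  let ?I = "case_bool I J"
  have "indep_sets gen (\<Union>b. ?I b)"
    using I J by (intro indep_sets_mono_index[OF _ indep_gen]) (auto split: bool.splits)
  moreover have "disjoint_family_on ?I UNIV"
    using disj by (auto simp: disjoint_family_on_def split: bool.splits)
  ultimately have ind: "indep_sets (\<lambda>b. sigma_sets (space M) (\<Union>x\<in>?I b. gen x)) UNIV"
    by (intro indep_sets_collect_sigma Int_stable_gen)
  show ?thesis
  proof (rule pair_measure_eqI[symmetric])
    show "sigma_finite_measure (distr M N X)" "sigma_finite_measure (distr M N' Y)" by unfold_locales
    fix A B assume "A \<in> sets (distr M N X)" "B \<in> sets (distr M N' Y)"
    then have [measurable]: "A \<in> sets N" "B \<in> sets N'" by auto
    let ?A = "X -` A \<inter> space M" and ?B = "Y -` B \<inter> space M"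
    have "?A \<in> sigma_sets (space M) (\<Union>x\<in>I. gen x)" "?B \<in> sigma_sets (space M) (\<Union>x\<in>J. gen x)"
      using measurable_sets[OF X, of A] measurable_sets[OF Y, of B] by (auto simp: sets_block)
    then have "prob (\<Inter>b\<in>UNIV. case_bool ?A ?B b) = (\<Prod>b\<in>UNIV. prob (case_bool ?A ?B b))"
      by (intro indep_setsD[OF ind]) (auto split: bool.splits)
    then have pr: "prob (?A \<inter> ?B) = prob ?A * prob ?B"
      by (simp add: UNIV_bool INT_bool_eq Int_commute mult.commute)
    have "emeasure (distr M (N \<Otimes>\<^sub>M N') (\<lambda>\<omega>. (X \<omega>, Y \<omega>))) (A \<times> B) = emeasure M (?A \<inter> ?B)"
      by (subst emeasure_distr) (auto intro!: arg_cong[where f="emeasure M"])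
    then show "emeasure (distr M N X) A * emeasure (distr M N' Y) B
        = emeasure (distr M (N \<Otimes>\<^sub>M N') (\<lambda>\<omega>. (X \<omega>, Y \<omega>))) (A \<times> B)"
      by (simp add: emeasure_distr emeasure_eq_measure pr ennreal_mult)
  qed simp
qed

section \<open>Laws of observations and of finite subarrays\<close>

lemma rest_law_general:
  assumes k: "1 \<le> k" and ij: "1 \<le> i" "i < j"
  shows "distr M (S \<Otimes>\<^sub>M T) (\<lambda>\<omega>. (U k \<omega>, V i j \<omega>)) = rest_law"
proof -
  \<comment> \<open>Node and dyad variables have distinct indices even if \<open>k\<close> is an
    endpoint of the dyad, so the law is a product in every case.\<close>
  have "distr M (S \<Otimes>\<^sub>M T) (\<lambda>\<omega>. (U k \<omega>, V i j \<omega>)) = node_law \<Otimes>\<^sub>M dyad_law" if "1 \<le> k" "1 \<le> i" "i < j" for k i j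
    using indep_blocks[of "{Inl k}" "{Inr (i, j)}" "U k" S "V i j" T] U_block[of k "{Inl k}"]
      V_block[of i j "{Inr (i, j)}"] node_identical[of k] dyad_identical[of i j] that
    by (auto simp: indices_def)
  from this[OF assms] this[of 2 1 2] show ?thesis by simp
qed

text \<open>Splitting off node \<open>k\<close> leaves a pair with law \<open>rest_law\<close>. The
  triple of variables entering the observation therefore has one and the same product law for all
  distinct \<open>k\<close> and \<open>l\<close>, in either order.\<close>

lemma Z_law:
  assumes kl: "1 \<le> k" "1 \<le> l" "k \<noteq> l"
  shows "distr M (obs_space \<X>) (Z k l) = obs_law M U V \<tau> \<X>"
proof -
  have eq: "distr M (S \<Otimes>\<^sub>M (S \<Otimes>\<^sub>M T)) (\<lambda>\<omega>. (U k \<omega>, U l \<omega>, V (min k l) (max k l) \<omega>)) = node_law \<Otimes>\<^sub>M rest_law"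
    if kl: "1 \<le> k" "1 \<le> l" "k \<noteq> l" for k l
  proof -
    let ?J = "{Inl l, Inr (min k l, max k l)} :: (nat + nat \<times> nat) set"
    have m: "1 \<le> min k l" "min k l < max k l" using kl by auto
    have [measurable]: "U l \<in> measurable (block ?J) S" "V (min k l) (max k l) \<in> measurable (block ?J) T"
      using U_block[of l ?J] V_block[of "min k l" "max k l" ?J] kl m by auto
    have "distr M (S \<Otimes>\<^sub>M (S \<Otimes>\<^sub>M T)) (\<lambda>\<omega>. (U k \<omega>, U l \<omega>, V (min k l) (max k l) \<omega>))
        = distr M S (U k) \<Otimes>\<^sub>M distr M (S \<Otimes>\<^sub>M T) (\<lambda>\<omega>. (U l \<omega>, V (min k l) (max k l) \<omega>))"
    proof (rule indep_blocks)
      show "{Inl k} \<subseteq> indices" "?J \<subseteq> indices" "{Inl k} \<inter> ?J = {}"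
        using kl m by (auto simp: indices_def)
      show "U k \<in> measurable (block {Inl k}) S" using U_block[of k "{Inl k}"] kl by simp
    qed measurable
    then show ?thesis
      by (simp only: node_identical[OF kl(1)] rest_law_general[OF kl(2) m])
  qed
  have "distr M (obs_space \<X>) (Z k l)
      = distr (node_law \<Otimes>\<^sub>M rest_law) (obs_space \<X>) (\<lambda>(u, v, w). \<tau> u v w)" if kl: "1 \<le> k" "1 \<le> l" "k \<noteq> l" for k l
  proof -
    have [measurable]: "U k \<in> measurable M S" "U l \<in> measurable M S" "V (min k l) (max k l) \<in> measurable M T"
      using kl by (auto intro!: node_measurable dyad_measurable)
    have "Z k l = (\<lambda>\<omega>. \<tau> (U k \<omega>) (U l \<omega>) (V (min k l) (max k l) \<omega>))"
      by (simp add: dyad_obs_def fun_eq_iff)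
    then show ?thesis unfolding eq[OF kl, symmetric]
      by (subst distr_distr[OF tau_measurable]) (auto simp: comp_def)
  qed
  from this[OF assms] this[of 1 2] show ?thesis by (simp add: obs_law_def)
qed

text \<open>The right-hand side does not depend on the selections \<open>a\<close> and
  \<open>b\<close>, which is the source of exchangeability. Nodes and dyads are first treated
  separately, each with a single value type, and then joined by \<open>indep_blocks\<close>.\<close>

lemma array_law:
  assumes K: "K \<noteq> {}" "finite K" "inj_on a K" "a ` K \<subseteq> {1..}"
    and D: "D \<noteq> {}" "finite D" "inj_on b D" "b ` D \<subseteq> {(i, j). 1 \<le> i \<and> i < j}"
  shows "distr M (PiM K (\<lambda>_. S) \<Otimes>\<^sub>M PiM D (\<lambda>_. T))
      (\<lambda>\<omega>. (\<lambda>k\<in>K. U (a k) \<omega>, \<lambda>p\<in>D. V (fst (b p)) (snd (b p)) \<omega>))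
    = PiM K (\<lambda>_. node_law) \<Otimes>\<^sub>M PiM D (\<lambda>_. dyad_law)"
proof -
  have Ka: "1 \<le> a k" if "k \<in> K" for k using K(4) that by auto
  have Db: "1 \<le> fst (b p)" "fst (b p) < snd (b p)" if "p \<in> D" for p using D(4) that by (auto simp: image_subset_iff split_beta)
  have "indep_sets (\<lambda>k. gen (Inl (a k))) K"
  proof (rule indep_sets_reindex[where F=gen and h="\<lambda>k. Inl (a k)"])
    show "inj_on (\<lambda>k. Inl (a k) :: nat + nat \<times> nat) K" using K(3) by (auto simp: inj_on_def)
    show "indep_sets gen ((\<lambda>k. Inl (a k)) ` K)"
      using Ka by (intro indep_sets_mono_index[OF _ indep_gen]) (auto simp: indices_def)
  qed
  then have "indep_vars (\<lambda>_. S) (\<lambda>k. U (a k)) K"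
    using Ka by (auto simp: indep_vars_def2 gen_def node_measurable)
  then have "distr M (PiM K (\<lambda>_. S)) (\<lambda>\<omega>. \<lambda>k\<in>K. U (a k) \<omega>) = PiM K (\<lambda>k. distr M S (U (a k)))"
    using Ka K(1) by (subst indep_vars_iff_distr_eq_PiM'[symmetric]) (auto simp: node_measurable)
  also have "\<dots> = PiM K (\<lambda>_. node_law)"
    by (intro PiM_cong refl node_identical Ka)
  finally have lawU: "distr M (PiM K (\<lambda>_. S)) (\<lambda>\<omega>. \<lambda>k\<in>K. U (a k) \<omega>) = PiM K (\<lambda>_. node_law)" .
  have "indep_sets (\<lambda>p. gen (Inr (b p))) D"
  proof (rule indep_sets_reindex[where F=gen and h="\<lambda>k. Inr (b k)"])
    show "inj_on (\<lambda>k. Inr (b k) :: nat + nat \<times> nat) D" using D(3) by (auto simp: inj_on_def)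
    show "indep_sets gen ((\<lambda>k. Inr (b k)) ` D)"
      using D(4) by (intro indep_sets_mono_index[OF _ indep_gen]) (auto simp: indices_def)
  qed
  then have "indep_vars (\<lambda>_. T) (\<lambda>p. V (fst (b p)) (snd (b p))) D"
    using Db by (auto simp: indep_vars_def2 gen_def dyad_measurable split_beta)
  then have "distr M (PiM D (\<lambda>_. T)) (\<lambda>\<omega>. \<lambda>p\<in>D. V (fst (b p)) (snd (b p)) \<omega>)
      = PiM D (\<lambda>p. distr M T (V (fst (b p)) (snd (b p))))"
    using Db D(1) by (subst indep_vars_iff_distr_eq_PiM'[symmetric]) (auto simp: dyad_measurable)
  also have "\<dots> = PiM D (\<lambda>_. dyad_law)"
    by (intro PiM_cong refl dyad_identical Db)
  finally have lawV: "distr M (PiM D (\<lambda>_. T)) (\<lambda>\<omega>. \<lambda>p\<in>D. V (fst (b p)) (snd (b p)) \<omega>) = PiM D (\<lambda>_. dyad_law)" .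
  show ?thesis unfolding lawU[symmetric] lawV[symmetric]
  proof (rule indep_blocks)
    show "Inl ` a ` K \<subseteq> indices" "Inr ` b ` D \<subseteq> indices" "Inl ` a ` K \<inter> Inr ` b ` D = {}"
      using Ka D(4) by (auto simp: indices_def)
    show "(\<lambda>\<omega>. \<lambda>k\<in>K. U (a k) \<omega>) \<in> measurable (block (Inl ` a ` K)) (PiM K (\<lambda>_. S))"
      using Ka by (intro measurable_restrict U_block) auto
    show "(\<lambda>\<omega>. \<lambda>p\<in>D. V (fst (b p)) (snd (b p)) \<omega>) \<in> measurable (block (Inr ` b ` D)) (PiM D (\<lambda>_. T))"
      using Db by (intro measurable_restrict V_block) auto
  qed
qed

lemma tau_space:
  "u \<in> space S \<Longrightarrow> v \<in> space S \<Longrightarrow> w \<in> space T \<Longrightarrow> \<tau> u v w \<in> space (obs_space \<X>)"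
  using measurable_space[OF tau_measurable, of "(u, v, w)"] by (auto simp: space_pair_measure)

lemma Z_measurable: "1 \<le> k \<Longrightarrow> 1 \<le> l \<Longrightarrow> k \<noteq> l \<Longrightarrow> Z k l \<in> measurable M (obs_space \<X>)"
proof -
  assume kl: "1 \<le> k" "1 \<le> l" "k \<noteq> l"
  then have [measurable]: "U k \<in> measurable M S" "U l \<in> measurable M S" "V (min k l) (max k l) \<in> measurable M T"
    by (auto intro!: node_measurable dyad_measurable)
  have "Z k l = (\<lambda>\<omega>. \<tau> (U k \<omega>) (U l \<omega>) (V (min k l) (max k l) \<omega>))"
    by (simp add: dyad_obs_def fun_eq_iff)
  then show ?thesis by simp
qed

text \<open>Both integrands are one functional of a finite array, evaluated at the renamed and at
  the original variables. By \<open>array_law\<close> both arrays have the same law. Countability of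
  the class makes the functional measurable.\<close>

lemma exchangeable:
  assumes G: "countable \<G>" "\<G> \<subseteq> borel_measurable (obs_space \<X>)" and n: "0 < n"
    and \<rho>: "inj \<rho>" "\<And>k. 1 \<le> k \<Longrightarrow> 1 \<le> \<rho> k"
  shows "(\<integral>\<^sup>+\<omega>. (SUP g\<in>\<G>. ennreal \<bar>\<Sum>p\<in>dyads n. ghost n (\<lambda>k l. g (Z (\<rho> k) (\<rho> l) \<omega>)) p\<bar>) \<partial>M)
    = (\<integral>\<^sup>+\<omega>. (SUP g\<in>\<G>. ennreal \<bar>\<Sum>p\<in>dyads n. ghost n (\<lambda>k l. g (Z k l \<omega>)) p\<bar>) \<partial>M)"
proof -
  let ?K = "{1..2 * n}" and ?D = "dyads (2 * n)"
  let ?P = "PiM ?K (\<lambda>_. S) \<Otimes>\<^sub>M PiM ?D (\<lambda>_. T)"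
  define z where "z x k l = \<tau> (fst x k) (fst x l) (snd x (min k l, max k l))" for x and k l :: nat
  define \<Phi> where "\<Phi> x = (SUP g\<in>\<G>. ennreal \<bar>\<Sum>p\<in>dyads n. ghost n (\<lambda>k l. g (z x k l)) p\<bar>)" for x
  have z_meas: "(\<lambda>x. g (z x k l)) \<in> borel_measurable ?P"
    if "g \<in> \<G>" "k \<in> ?K" "l \<in> ?K" "k \<noteq> l" for g k l
  proof -
    have g: "g \<in> borel_measurable (obs_space \<X>)" using G that by auto
    have D: "(min k l, max k l) \<in> ?D" using that by (auto simp: dyads_def)
    have [measurable]: "(\<lambda>x. fst x k) \<in> measurable ?P S" "(\<lambda>x. fst x l) \<in> measurable ?P S"
      "(\<lambda>x. snd x (min k l, max k l)) \<in> measurable ?P T"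
      using that D by measurable
    show ?thesis unfolding z_def by (rule measurable_compose[OF _ g]) measurable
  qed
  have "(\<lambda>x. ghost n (\<lambda>k l. g (z x k l)) p) \<in> borel_measurable ?P" if "g \<in> \<G>" "p \<in> dyads n" for g p
    using that unfolding ghost_def
    by (intro borel_measurable_add borel_measurable_diff z_meas) (auto simp: dyads_def)
  then have \<Phi>_meas: "\<Phi> \<in> borel_measurable ?P"
    unfolding \<Phi>_def using G(1)
    by (intro borel_measurable_SUP measurable_ennreal borel_measurable_abs borel_measurable_sum) auto
  have *: "(\<integral>\<^sup>+\<omega>. (SUP g\<in>\<G>. ennreal \<bar>\<Sum>p\<in>dyads n. ghost n (\<lambda>k l. g (Z (\<rho> k) (\<rho> l) \<omega>)) p\<bar>) \<partial>M)
      = integral\<^sup>N (PiM ?K (\<lambda>_. node_law) \<Otimes>\<^sub>M PiM ?D (\<lambda>_. dyad_law)) \<Phi>"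
    if \<rho>: "inj \<rho>" "\<And>k. 1 \<le> k \<Longrightarrow> 1 \<le> \<rho> k" for \<rho>
  proof -
    \<comment> \<open>The renaming may reverse the order of a dyad, whereas dyad variables live on
      increasing pairs; hence \<open>min\<close> and \<open>max\<close>. Injectivity survives
      because the pairs in \<open>?D\<close> are increasing.\<close>
    define b where "b p = (min (\<rho> (fst p)) (\<rho> (snd p)), max (\<rho> (fst p)) (\<rho> (snd p)))" for p
    have ne: "\<rho> k \<noteq> \<rho> l" if "k \<noteq> l" for k l using \<rho>(1) that by (auto simp: inj_def)
    have b_inj: "inj_on b ?D"
    proof (rule inj_onI)
      fix p q assume "p \<in> ?D" "q \<in> ?D" and eq: "b p = b q"
      then have lt: "fst p < snd p" "fst q < snd q" by (auto simp: dyads_def)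
      from eq have "\<rho> (fst p) = \<rho> (fst q) \<and> \<rho> (snd p) = \<rho> (snd q) \<or> \<rho> (fst p) = \<rho> (snd q) \<and> \<rho> (snd p) = \<rho> (fst q)"
        by (auto simp: b_def min_def max_def split: if_splits)
      with \<rho>(1) have "fst p = fst q \<and> snd p = snd q \<or> fst p = snd q \<and> snd p = fst q"
        by (auto simp: inj_def)
      with lt show "p = q" by (auto simp: prod_eq_iff)
    qed
    have b_ran: "b ` ?D \<subseteq> {(i, j). 1 \<le> i \<and> i < j}"
    proof clarify
      fix k l i j assume "(k, l) \<in> ?D" "(i, j) = b (k, l)"
      then show "1 \<le> i \<and> i < j"
        using ne[of k l] \<rho>(2)[of k] \<rho>(2)[of l] by (auto simp: b_def dyads_def min_def max_def)
    qed
    define X where "X \<omega> = (\<lambda>k\<in>?K. U (\<rho> k) \<omega>, \<lambda>p\<in>?D. V (fst (b p)) (snd (b p)) \<omega>)" for \<omega>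
    have X_meas: "X \<in> measurable M ?P"
      unfolding X_def using \<rho>(2) b_ran
      by (intro measurable_Pair measurable_restrict node_measurable dyad_measurable)
         (auto simp: image_subset_iff split_beta)
    have law: "distr M ?P X = PiM ?K (\<lambda>_. node_law) \<Otimes>\<^sub>M PiM ?D (\<lambda>_. dyad_law)"
      unfolding X_def
    proof (rule array_law)
      have "(1, 2) \<in> ?D" using n by (simp add: dyads_def)
      then show "?D \<noteq> {}" by blast
      show "inj_on \<rho> ?K" using \<rho>(1) by (rule inj_on_subset) simp
    qed (use n \<rho>(2) b_inj b_ran in auto)
    have zX: "z (X \<omega>) k l = Z (\<rho> k) (\<rho> l) \<omega>" if "k \<in> ?K" "l \<in> ?K" "k \<noteq> l" for k l \<omega>
    proof -
      have "(min k l, max k l) \<in> ?D" using that by (auto simp: dyads_def)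
      moreover have "b (min k l, max k l) = (min (\<rho> k) (\<rho> l), max (\<rho> k) (\<rho> l))"
        by (auto simp: b_def min_def max_def)
      ultimately show ?thesis using that by (simp add: z_def X_def dyad_obs_def)
    qed
    have "\<Phi> (X \<omega>) = (SUP g\<in>\<G>. ennreal \<bar>\<Sum>p\<in>dyads n. ghost n (\<lambda>k l. g (Z (\<rho> k) (\<rho> l) \<omega>)) p\<bar>)" for \<omega>
      unfolding \<Phi>_def
      by (intro SUP_cong refl arg_cong[where f="\<lambda>x. ennreal \<bar>x\<bar>"] sum.cong)
         (auto simp: ghost_def dyads_def zX)
    then show ?thesis
      unfolding law[symmetric] using nn_integral_distr[OF X_meas, of \<Phi>] \<Phi>_meas by simp
  qed
  show ?thesis
    by (rule trans[OF *[OF \<rho>] *[of "\<lambda>k. k", symmetric]]) auto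
qed

text \<open>The alternating sum with the first \<open>n\<close> nodes taken at \<open>\<omega>\<close> and the ghost nodes at \<open>\<omega>'\<close>.\<close>

definition mix :: "(real \<times> (real^'d) \<Rightarrow> real) \<Rightarrow> nat \<Rightarrow> 'w \<Rightarrow> 'w \<Rightarrow> nat \<times> nat \<Rightarrow> real" where
  "mix g n \<omega> \<omega>' = (\<lambda>(i, j). g (\<tau> (U i \<omega>) (U j \<omega>) (V i j \<omega>))
      - g (\<tau> (U i \<omega>) (U (j + n) \<omega>') (V i (j + n) \<omega>'))
      - g (\<tau> (U (i + n) \<omega>') (U j \<omega>) (V j (i + n) \<omega>'))
      + g (\<tau> (U (i + n) \<omega>') (U (j + n) \<omega>') (V (i + n) (j + n) \<omega>')))"

text \<open>Since \<open>j \<le> n < i + n\<close>, sorting the indices of the third term puts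
  \<open>j\<close> first, which matches the dyad variable chosen in \<open>mix\<close>.\<close>

lemma mix_diagonal: "p \<in> dyads n \<Longrightarrow> mix g n \<omega> \<omega> p = ghost n (\<lambda>k l. g (Z k l \<omega>)) p"
  by (auto simp: mix_def ghost_def dyad_obs_def dyads_def min_def max_def)

text \<open>The first argument of \<open>mix\<close> enters through nodes up to \<open>n\<close> and
  the dyads among them, the second through ghost nodes and dyads with a ghost endpoint. These blocks
  are disjoint, so by Fubini integrating over two separate sample points equals integrating on the
  diagonal.\<close>

lemma mix_decouple:
  assumes G: "countable \<G>" "\<G> \<subseteq> borel_measurable (obs_space \<X>)"
  shows "(\<lambda>\<omega>. \<integral>\<^sup>+\<omega>'. (SUP g\<in>\<G>. ennreal \<bar>\<Sum>p\<in>dyads n. mix g n \<omega> \<omega>' p\<bar>) \<partial>M) \<in> borel_measurable M"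
    and "(\<integral>\<^sup>+\<omega>. (\<integral>\<^sup>+\<omega>'. (SUP g\<in>\<G>. ennreal \<bar>\<Sum>p\<in>dyads n. mix g n \<omega> \<omega>' p\<bar>) \<partial>M) \<partial>M)
    = (\<integral>\<^sup>+\<omega>. (SUP g\<in>\<G>. ennreal \<bar>\<Sum>p\<in>dyads n. ghost n (\<lambda>k l. g (Z k l \<omega>)) p\<bar>) \<partial>M)"
proof -
  define I where "I = (Inl ` {1..n} \<union> Inr ` dyads n :: (nat + nat \<times> nat) set)"
  define J where "J = (Inl ` {n<..} \<union> Inr ` {(i, j). 1 \<le> i \<and> i < j \<and> n < j} :: (nat + nat \<times> nat) set)"
  have IJ: "I \<subseteq> indices" "J \<subseteq> indices" "I \<inter> J = {}"
    by (auto simp: I_def J_def indices_def dyads_def)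
  let ?A = "distr M (block I) (\<lambda>\<omega>. \<omega>)" and ?B = "distr M (block J) (\<lambda>\<omega>. \<omega>)"
  \<comment> \<open>Independence of the blocks, read off for the identity map: on the product of the
    two sigma-algebras the diagonal image of \<open>M\<close> is a product measure.\<close>
  have law: "distr M (block I \<Otimes>\<^sub>M block J) (\<lambda>\<omega>. (\<omega>, \<omega>)) = ?A \<Otimes>\<^sub>M ?B"
    by (rule indep_blocks[OF IJ]) auto
  note [measurable] = id_block[OF IJ(1)] id_block[OF IJ(2)]
  interpret A: prob_space ?A by (rule prob_space_distr) measurable
  interpret B: prob_space ?B by (rule prob_space_distr) measurable
  define \<Phi> where "\<Phi> x = (SUP g\<in>\<G>. ennreal \<bar>\<Sum>p\<in>dyads n. mix g n (fst x) (snd x) p\<bar>)" for x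
  have "(\<lambda>x. mix g n (fst x) (snd x) p) \<in> borel_measurable (block I \<Otimes>\<^sub>M block J)" if "g \<in> \<G>" "p \<in> dyads n" for g p
  proof -
    obtain i j where p: "p = (i, j)" by (cases p)
    then have ij: "1 \<le> i" "i < j" "j \<le> n" using that by (auto simp: dyads_def)
    have [measurable]: "g \<in> borel_measurable (obs_space \<X>)" using G that by auto
    have [measurable]: "U i \<in> measurable (block I) S" "U j \<in> measurable (block I) S" "V i j \<in> measurable (block I) T"
      using ij by (auto intro!: U_block V_block simp: I_def dyads_def)
    have [measurable]: "U (i + n) \<in> measurable (block J) S" "U (j + n) \<in> measurable (block J) S"
      "V i (j + n) \<in> measurable (block J) T" "V j (i + n) \<in> measurable (block J) T"
      "V (i + n) (j + n) \<in> measurable (block J) T"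
      using ij by (auto intro!: U_block V_block simp: J_def)
    show ?thesis unfolding p mix_def prod.case by measurable
  qed
  then have \<Phi>_meas [measurable]: "\<Phi> \<in> borel_measurable (block I \<Otimes>\<^sub>M block J)"
    unfolding \<Phi>_def using G(1)
    by (intro borel_measurable_SUP measurable_ennreal borel_measurable_abs borel_measurable_sum) auto
  have pair [measurable]: "(\<lambda>\<omega>. (\<omega>, \<omega>)) \<in> measurable M (block I \<Otimes>\<^sub>M block J)" by measurable
  have inner: "(\<integral>\<^sup>+\<omega>'. \<Phi> (\<omega>, \<omega>') \<partial>?B) = (\<integral>\<^sup>+\<omega>'. \<Phi> (\<omega>, \<omega>') \<partial>M)" if "\<omega> \<in> space M" for \<omega>
    using that by (intro nn_integral_distr) auto
  have "(\<lambda>\<omega>. \<integral>\<^sup>+\<omega>'. \<Phi> (\<omega>, \<omega>') \<partial>?B) \<in> borel_measurable (block I)"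
    by (rule B.borel_measurable_nn_integral) simp
  then have "(\<lambda>\<omega>. \<integral>\<^sup>+\<omega>'. \<Phi> (\<omega>, \<omega>') \<partial>?B) \<in> borel_measurable M"
    by (rule measurable_compose[OF id_block[OF IJ(1)]])
  then have "(\<lambda>\<omega>. \<integral>\<^sup>+\<omega>'. \<Phi> (\<omega>, \<omega>') \<partial>M) \<in> borel_measurable M"
    by (rule measurable_cong[THEN iffD1, rotated]) (rule inner)
  then show "(\<lambda>\<omega>. \<integral>\<^sup>+\<omega>'. (SUP g\<in>\<G>. ennreal \<bar>\<Sum>p\<in>dyads n. mix g n \<omega> \<omega>' p\<bar>) \<partial>M) \<in> borel_measurable M"
    by (simp add: \<Phi>_def)
  have "(\<integral>\<^sup>+\<omega>. \<Phi> (\<omega>, \<omega>) \<partial>M) = integral\<^sup>N (?A \<Otimes>\<^sub>M ?B) \<Phi>"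
    unfolding law[symmetric] by (subst nn_integral_distr[OF pair]) auto
  also have "\<dots> = (\<integral>\<^sup>+\<omega>. (\<integral>\<^sup>+\<omega>'. \<Phi> (\<omega>, \<omega>') \<partial>?B) \<partial>?A)"
    by (rule B.nn_integral_fst[symmetric]) simp
  also have "\<dots> = (\<integral>\<^sup>+\<omega>. (\<integral>\<^sup>+\<omega>'. \<Phi> (\<omega>, \<omega>') \<partial>?B) \<partial>M)"
    by (subst nn_integral_distr) (auto intro!: B.borel_measurable_nn_integral)
  also have "\<dots> = (\<integral>\<^sup>+\<omega>. (\<integral>\<^sup>+\<omega>'. \<Phi> (\<omega>, \<omega>') \<partial>M) \<partial>M)"
    by (intro nn_integral_cong inner)
  finally show "(\<integral>\<^sup>+\<omega>. (\<integral>\<^sup>+\<omega>'. (SUP g\<in>\<G>. ennreal \<bar>\<Sum>p\<in>dyads n. mix g n \<omega> \<omega>' p\<bar>) \<partial>M) \<partial>M)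
    = (\<integral>\<^sup>+\<omega>. (SUP g\<in>\<G>. ennreal \<bar>\<Sum>p\<in>dyads n. ghost n (\<lambda>k l. g (Z k l \<omega>)) p\<bar>) \<partial>M)"
    by (simp add: \<Phi>_def mix_diagonal cong: sum.cong)
qed

section \<open>Projections as conditional means over the ghost nodes\<close>

text \<open>The exceptional null set from Fubini's theorem depends on the envelope alone. It can
  therefore be discarded once for the whole, possibly uncountable, class.\<close>

lemma AE_rest_integrable:
  fixes F :: "real \<times> (real^'d) \<Rightarrow> real"
  assumes F: "F \<in> borel_measurable (obs_space \<X>)" "integrable (obs_law M U V \<tau> \<X>) F"
  shows "AE \<omega> in M. \<forall>i\<in>{1..n}. integrable rest_law (\<lambda>y. F (\<tau> (U i \<omega>) (fst y) (snd y)))"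
proof -
  interpret X: prob_space node_law by (rule prob_space_distr) measurable
  interpret Y: prob_space rest_law by (rule prob_space_distr) measurable
  interpret XY: pair_prob_space node_law rest_law ..
  let ?good = "\<lambda>u. integrable rest_law (\<lambda>y. F (\<tau> u (fst y) (snd y)))"
  have "AE u in node_law. ?good u"
    using XY.AE_integrable_fst'[OF integrable_joint[OF F]] by simp
  then have "AE u in distr M S (U i). ?good u" if "1 \<le> i" for i
    unfolding node_identical[OF that] .
  then have "AE \<omega> in M. ?good (U i \<omega>)" if "1 \<le> i" for i
    using that by (intro AE_distrD[OF node_measurable]) auto
  then show ?thesis
    by (intro AE_finite_allI) auto
qed

text \<open>With the first sample point frozen, the two mixed terms integrate to the conditional
  means at \<open>U i \<omega>\<close> and \<open>U j \<omega>\<close>, the all-ghost term to the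
  mean. As each first-order projection subtracts the mean once, this combination is the second-order
  projection.\<close>

lemma proj2_eq_integral_mix:
  fixes F f :: "real \<times> (real^'d) \<Rightarrow> real"
  assumes f [measurable]: "f \<in> borel_measurable (obs_space \<X>)"
    and env: "\<And>z. z \<in> space (obs_space \<X>) \<Longrightarrow> \<bar>f z\<bar> \<le> F z"
    and F: "integrable (obs_law M U V \<tau> \<X>) F"
    and \<omega>: "\<omega> \<in> space M"
    and good: "\<And>i. i \<in> {1..n} \<Longrightarrow> integrable rest_law (\<lambda>y. F (\<tau> (U i \<omega>) (fst y) (snd y)))"
    and ij: "(i, j) \<in> dyads n"
  shows "integrable M (\<lambda>\<omega>'. mix f n \<omega> \<omega>' (i, j))"
    and "(\<integral>\<omega>'. mix f n \<omega> \<omega>' (i, j) \<partial>M) = proj2 M U V \<tau> \<X> f (U i \<omega>) (U j \<omega>) (V i j \<omega>)"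
proof -
  note Us = measurable_space[OF node_measurable]
  note Vs = measurable_space[OF dyad_measurable]
  have law [simp]: "sets (obs_law M U V \<tau> \<X>) = sets (obs_space \<X>)"
    by (simp add: obs_law_def)
  have ij': "1 \<le> i" "i < j" "j \<le> n" using ij by (auto simp: dyads_def)
  have half: "integrable M (\<lambda>\<omega>'. f (\<tau> (U h \<omega>) (U k \<omega>') (V a b \<omega>')))"
    "(\<integral>\<omega>'. f (\<tau> (U h \<omega>) (U k \<omega>') (V a b \<omega>')) \<partial>M) = cond_mean M U V \<tau> f (U h \<omega>)"
    if h: "h \<in> {1..n}" and k: "1 \<le> k" "1 \<le> a" "a < b" for h k a b
  proof -
    have u [measurable]: "U h \<omega> \<in> space S" using Us \<omega> h by simp
    have [measurable]: "(\<lambda>\<omega>'. (U k \<omega>', V a b \<omega>')) \<in> measurable M (S \<Otimes>\<^sub>M T)"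
      using k by (intro measurable_Pair node_measurable dyad_measurable)
    let ?f = "\<lambda>y. f (\<tau> (U h \<omega>) (fst y) (snd y))"
    have "norm (?f y) \<le> norm (F (\<tau> (U h \<omega>) (fst y) (snd y)))" if "y \<in> space rest_law" for y
    proof -
      from that have "fst y \<in> space S" "snd y \<in> space T" by (auto simp: space_pair_measure)
      from env[OF tau_space[OF u this]] show ?thesis by simp
    qed
    then have "integrable rest_law ?f"
      by (intro Bochner_Integration.integrable_bound[OF good[OF h]] AE_I2) simp_all
    then show "integrable M (\<lambda>\<omega>'. f (\<tau> (U h \<omega>) (U k \<omega>') (V a b \<omega>')))"
      unfolding rest_law_general[OF k, symmetric] by (subst (asm) integrable_distr_eq) auto
    have "(\<integral>\<omega>'. ?f (U k \<omega>', V a b \<omega>') \<partial>M) = (\<integral>y. ?f y \<partial>rest_law)"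
      unfolding rest_law_general[OF k, symmetric] by (subst integral_distr) auto
    then show "(\<integral>\<omega>'. f (\<tau> (U h \<omega>) (U k \<omega>') (V a b \<omega>')) \<partial>M) = cond_mean M U V \<tau> f (U h \<omega>)"
      using cond_mean_rest_law[OF f u] by simp
  qed
  have sym: "\<tau> (U (i + n) \<omega>') (U j \<omega>) (V j (i + n) \<omega>') = \<tau> (U j \<omega>) (U (i + n) \<omega>') (V j (i + n) \<omega>')" if "\<omega>' \<in> space M" for \<omega>'
    using Us Vs \<omega> that ij' by (intro tau_symmetric) auto
  have Zf: "integrable M (\<lambda>\<omega>'. f (Z (i + n) (j + n) \<omega>'))"
    "(\<integral>\<omega>'. f (Z (i + n) (j + n) \<omega>') \<partial>M) = (\<integral>z. f z \<partial>obs_law M U V \<tau> \<X>)"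
  proof -
    have k: "1 \<le> i + n" "1 \<le> j + n" "i + n \<noteq> j + n" using ij' by auto
    have "norm (f z) \<le> norm (F z)" if "z \<in> space (obs_law M U V \<tau> \<X>)" for z
      using env[of z] that by (simp add: obs_law_def)
    then have "integrable (obs_law M U V \<tau> \<X>) f"
      by (intro Bochner_Integration.integrable_bound[OF F] AE_I2) (simp_all add: obs_law_def)
    then show "integrable M (\<lambda>\<omega>'. f (Z (i + n) (j + n) \<omega>'))"
      unfolding Z_law[OF k, symmetric] using Z_measurable[OF k] by (subst (asm) integrable_distr_eq) auto
    show "(\<integral>\<omega>'. f (Z (i + n) (j + n) \<omega>') \<partial>M) = (\<integral>z. f z \<partial>obs_law M U V \<tau> \<X>)"
      unfolding Z_law[OF k, symmetric] using Z_measurable[OF k] by (subst integral_distr) auto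
  qed
  have Z_eq: "Z (i + n) (j + n) \<omega>' = \<tau> (U (i + n) \<omega>') (U (j + n) \<omega>') (V (i + n) (j + n) \<omega>')" for \<omega>'
    using ij' by (simp add: dyad_obs_def)
  have mix: "mix f n \<omega> \<omega>' (i, j) = f (\<tau> (U i \<omega>) (U j \<omega>) (V i j \<omega>))
      - f (\<tau> (U i \<omega>) (U (j + n) \<omega>') (V i (j + n) \<omega>'))
      - f (\<tau> (U j \<omega>) (U (i + n) \<omega>') (V j (i + n) \<omega>')) + f (Z (i + n) (j + n) \<omega>')" if "\<omega>' \<in> space M" for \<omega>'
    using sym[OF that] by (simp add: mix_def Z_eq)
  have t: "i \<in> {1..n}" "j \<in> {1..n}" "1 \<le> j + n" "1 \<le> i + n" "i < j + n" "j < i + n" "1 \<le> j" using ij' by auto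
  note i1 = half[OF t(1,3) ij'(1) t(5)] and i2 = half[OF t(2,4,7,6)]
  show "integrable M (\<lambda>\<omega>'. mix f n \<omega> \<omega>' (i, j))"
    using i1(1) i2(1) Zf(1) by (subst Bochner_Integration.integrable_cong[OF refl mix]) auto
  have "(\<integral>\<omega>'. mix f n \<omega> \<omega>' (i, j) \<partial>M) = f (\<tau> (U i \<omega>) (U j \<omega>) (V i j \<omega>))
      - cond_mean M U V \<tau> f (U i \<omega>) - cond_mean M U V \<tau> f (U j \<omega>) + (\<integral>z. f z \<partial>obs_law M U V \<tau> \<X>)"
    using i1 i2 Zf by (subst Bochner_Integration.integral_cong[OF refl mix]) (auto simp: prob_space)
  then show "(\<integral>\<omega>'. mix f n \<omega> \<omega>' (i, j) \<partial>M) = proj2 M U V \<tau> \<X> f (U i \<omega>) (U j \<omega>) (V i j \<omega>)"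
    by (simp add: proj2_def proj1_def)
qed

text \<open>Jensen's inequality moves the absolute value inside the ghost integral, and pointwise
  approximation of \<open>f\<close> from the countable subclass bounds the integrand. The right-hand
  side is the same for every \<open>f\<close>.\<close>

lemma proj2_le_mix:
  fixes F f :: "real \<times> (real^'d) \<Rightarrow> real"
  assumes f: "f \<in> borel_measurable (obs_space \<X>)"
    and env: "\<And>z. z \<in> space (obs_space \<X>) \<Longrightarrow> \<bar>f z\<bar> \<le> F z"
    and F: "integrable (obs_law M U V \<tau> \<X>) F"
    and \<omega>: "\<omega> \<in> space M"
    and good: "\<And>i. i \<in> {1..n} \<Longrightarrow> integrable rest_law (\<lambda>y. F (\<tau> (U i \<omega>) (fst y) (snd y)))"
    and g: "\<And>k. g k \<in> \<G>" "\<And>z. z \<in> space (obs_space \<X>) \<Longrightarrow> (\<lambda>k. g k z) \<longlonglongrightarrow> f z"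
  shows "ennreal \<bar>\<Sum>(i, j)\<in>dyads n. proj2 M U V \<tau> \<X> f (U i \<omega>) (U j \<omega>) (V i j \<omega>)\<bar>
    \<le> (\<integral>\<^sup>+\<omega>'. (SUP g\<in>\<G>. ennreal \<bar>\<Sum>p\<in>dyads n. mix g n \<omega> \<omega>' p\<bar>) \<partial>M)"
proof -
  note mix = proj2_eq_integral_mix[OF f env F \<omega> good]
  have int: "integrable M (\<lambda>\<omega>'. \<Sum>p\<in>dyads n. mix f n \<omega> \<omega>' p)"
    using mix(1) by (intro Bochner_Integration.integrable_sum) auto
  have "(\<Sum>(i, j)\<in>dyads n. proj2 M U V \<tau> \<X> f (U i \<omega>) (U j \<omega>) (V i j \<omega>))
      = (\<Sum>p\<in>dyads n. \<integral>\<omega>'. mix f n \<omega> \<omega>' p \<partial>M)"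
    using mix(2) by (intro sum.cong) auto
  also have "\<dots> = (\<integral>\<omega>'. (\<Sum>p\<in>dyads n. mix f n \<omega> \<omega>' p) \<partial>M)"
    using mix(1) by (intro Bochner_Integration.integral_sum[symmetric]) auto
  finally have "ennreal \<bar>\<Sum>(i, j)\<in>dyads n. proj2 M U V \<tau> \<X> f (U i \<omega>) (U j \<omega>) (V i j \<omega>)\<bar>
      \<le> (\<integral>\<^sup>+\<omega>'. ennreal \<bar>\<Sum>p\<in>dyads n. mix f n \<omega> \<omega>' p\<bar> \<partial>M)"
    using integral_norm_bound_ennreal[OF int] by simp
  also have "\<dots> \<le> (\<integral>\<^sup>+\<omega>'. (SUP g\<in>\<G>. ennreal \<bar>\<Sum>p\<in>dyads n. mix g n \<omega> \<omega>' p\<bar>) \<partial>M)"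
  proof (rule nn_integral_mono)
    fix \<omega>' assume \<omega>': "\<omega>' \<in> space M"
    have sp: "U i \<omega> \<in> space S" "U i \<omega>' \<in> space S" if "1 \<le> i" for i
      using measurable_space[OF node_measurable[OF that]] \<omega> \<omega>' by auto
    have spV: "V i j \<omega> \<in> space T" "V i j \<omega>' \<in> space T" if "1 \<le> i" "i < j" for i j
      using measurable_space[OF dyad_measurable[OF that]] \<omega> \<omega>' by auto
    have "(\<lambda>k. \<Sum>p\<in>dyads n. mix (g k) n \<omega> \<omega>' p) \<longlonglongrightarrow> (\<Sum>p\<in>dyads n. mix f n \<omega> \<omega>' p)"
    proof (rule tendsto_sum)
      fix p assume "p \<in> dyads n"
      then obtain i j where "p = (i, j)" "1 \<le> i" "i < j" "j \<le> n" by (auto simp: dyads_def)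
      then show "(\<lambda>k. mix (g k) n \<omega> \<omega>' p) \<longlonglongrightarrow> mix f n \<omega> \<omega>' p"
        by (auto simp: mix_def intro!: tendsto_add tendsto_diff g(2) tau_space sp spV)
    qed
    then have "(\<lambda>k. ennreal \<bar>\<Sum>p\<in>dyads n. mix (g k) n \<omega> \<omega>' p\<bar>) \<longlonglongrightarrow> ennreal \<bar>\<Sum>p\<in>dyads n. mix f n \<omega> \<omega>' p\<bar>"
      by (intro tendsto_ennrealI tendsto_rabs)
    then show "ennreal \<bar>\<Sum>p\<in>dyads n. mix f n \<omega> \<omega>' p\<bar> \<le> (SUP g\<in>\<G>. ennreal \<bar>\<Sum>p\<in>dyads n. mix g n \<omega> \<omega>' p\<bar>)"
      by (rule LIMSEQ_le_const2) (auto intro!: exI[of _ 0] SUP_upper g(1))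
  qed
  finally show ?thesis .
qed

section \<open>Symmetrization and the bound on its expectation\<close>

text \<open>Every sign pattern gives the same expectation, so the expectation equals its average
  over all patterns. For fixed data this average is bounded by \<open>chaos_bound\<close>, applied
  to each of the four arrays that make up \<open>ghost\<close>.\<close>

lemma nn_integral_Sup_ghost_le:
  fixes F :: "real \<times> (real^'d) \<Rightarrow> real"
  assumes G: "countable \<G>" "\<G> \<subseteq> borel_measurable (obs_space \<X>)" and n: "0 < n"
    and F [measurable]: "F \<in> borel_measurable (obs_space \<X>)"
    and F2: "integrable (obs_law M U V \<tau> \<X>) (\<lambda>z. (F z)\<^sup>2)"
    and L: "0 \<le> L"
    and chaos_bound: "\<And>z. z ` dyads n \<subseteq> space (obs_space \<X>) \<Longrightarrow>
      \<exists>W. (\<forall>E. 0 \<le> W E \<and> (\<forall>g\<in>\<G>. \<bar>chaos E n (\<lambda>p. g (z p))\<bar> \<le> W E)) \<and>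
        (\<Sum>E\<in>Pow {1..n}. W E) \<le> 2 ^ n * (L * sqrt (\<Sum>p\<in>dyads n. (F (z p))\<^sup>2))"
  shows "(\<integral>\<^sup>+\<omega>. (SUP g\<in>\<G>. ennreal \<bar>\<Sum>p\<in>dyads n. ghost n (\<lambda>k l. g (Z k l \<omega>)) p\<bar>) \<partial>M)
    \<le> ennreal (2 * L * n * ((\<integral>z. (F z)\<^sup>2 \<partial>obs_law M U V \<tau> \<X>) + 1))" (is "?I \<le> _")
proof -
  define m2 where "m2 = (\<integral>z. (F z)\<^sup>2 \<partial>obs_law M U V \<tau> \<X>)"
  have m2: "0 \<le> m2" by (simp add: m2_def)
  define Y where "Y E \<omega> = (SUP g\<in>\<G>. ennreal \<bar>chaos E n (ghost n (\<lambda>k l. g (Z k l \<omega>)))\<bar>)" for E \<omega>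
  have ghost_meas: "(\<lambda>\<omega>. ghost n (\<lambda>k l. g (Z k l \<omega>)) p) \<in> borel_measurable M"
    if g: "g \<in> \<G>" and p: "p \<in> dyads n" for g p
  proof -
    have "(\<lambda>\<omega>. g (Z k l \<omega>)) \<in> borel_measurable M" if "1 \<le> k" "1 \<le> l" "k \<noteq> l" for k l
      using measurable_compose[OF Z_measurable[OF that]] g G by auto
    then show ?thesis using p n unfolding ghost_def
      by (intro borel_measurable_add borel_measurable_diff) (auto simp: dyads_def)
  qed
  have Y_meas: "Y E \<in> borel_measurable M" for E
    unfolding Y_def chaos_def using G(1) ghost_meas
    by (intro borel_measurable_SUP measurable_ennreal borel_measurable_abs borel_measurable_sum
        borel_measurable_times borel_measurable_const) auto
  \<comment> \<open>The signs are absorbed into the renaming \<open>swap E n\<close>, under which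
    the expectation is invariant.\<close>
  have Y_eq: "(\<integral>\<^sup>+\<omega>. Y E \<omega> \<partial>M) = ?I" if E: "E \<in> Pow {1..n}" for E
  proof -
    have E: "E \<subseteq> {1..n}" using that by simp
    have "(\<integral>\<^sup>+\<omega>. Y E \<omega> \<partial>M) = (\<integral>\<^sup>+\<omega>. (SUP g\<in>\<G>. ennreal \<bar>\<Sum>p\<in>dyads n.
        ghost n (\<lambda>k l. g (Z (swap E n k) (swap E n l) \<omega>)) p\<bar>) \<partial>M)"
      unfolding Y_def chaos_def by (simp add: ghost_swap[OF E, of _ "\<lambda>k l. _ (Z k l _)"] cong: sum.cong)
    also have "\<dots> = ?I"
      using E by (intro exchangeable G n inj_swap swap_range)
    finally show ?thesis .
  qed
  \<comment> \<open>The shifts \<open>c\<close> and \<open>d\<close> select original or ghost nodes;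
    as \<open>n\<close> is positive, the double sum has four summands.\<close>
  have pointwise: "(\<Sum>E\<in>Pow {1..n}. Y E \<omega>) \<le> ennreal (2 ^ n * (\<Sum>c\<in>{0, n}. \<Sum>d\<in>{0, n}.
      L * ((\<Sum>p\<in>dyads n. (F (Z (fst p + c) (snd p + d) \<omega>))\<^sup>2) / n + n) / 2))" if \<omega>: "\<omega> \<in> space M" for \<omega>
  proof -
    define z where "z c d p = Z (fst p + c) (snd p + d) \<omega>" for c d and p :: "nat \<times> nat"
    have "\<exists>W. (\<forall>E. 0 \<le> W E \<and> (\<forall>g\<in>\<G>. \<bar>chaos E n (\<lambda>p. g (z c d p))\<bar> \<le> W E)) \<and>
        (\<Sum>E\<in>Pow {1..n}. W E) \<le> 2 ^ n * (L * sqrt (\<Sum>p\<in>dyads n. (F (z c d p))\<^sup>2))"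
      if "c \<in> {0, n}" "d \<in> {0, n}" for c d
    proof (rule chaos_bound)
      show "z c d ` dyads n \<subseteq> space (obs_space \<X>)"
      proof (rule image_subsetI)
        fix p assume "p \<in> dyads n"
        then have "1 \<le> fst p + c" "1 \<le> snd p + d" "fst p + c \<noteq> snd p + d"
          using that by (auto simp: dyads_def)
        from measurable_space[OF Z_measurable[OF this] \<omega>]
        show "z c d p \<in> space (obs_space \<X>)" by (simp only: z_def)
      qed
    qed
    then obtain W where W: "\<And>c d E. c \<in> {0, n} \<Longrightarrow> d \<in> {0, n} \<Longrightarrow> 0 \<le> W c d E"
      "\<And>c d E g. c \<in> {0, n} \<Longrightarrow> d \<in> {0, n} \<Longrightarrow> g \<in> \<G> \<Longrightarrow> \<bar>chaos E n (\<lambda>p. g (z c d p))\<bar> \<le> W c d E"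
      "\<And>c d. c \<in> {0, n} \<Longrightarrow> d \<in> {0, n} \<Longrightarrow>
        (\<Sum>E\<in>Pow {1..n}. W c d E) \<le> 2 ^ n * (L * sqrt (\<Sum>p\<in>dyads n. (F (z c d p))\<^sup>2))"
      by metis
    have "Y E \<omega> \<le> ennreal (\<Sum>c\<in>{0, n}. \<Sum>d\<in>{0, n}. W c d E)" for E
      unfolding Y_def
    proof (intro SUP_least ennreal_leI)
      fix g assume g: "g \<in> \<G>"
      have "chaos E n (ghost n (\<lambda>k l. g (Z k l \<omega>)))
          = chaos E n (\<lambda>p. g (z 0 0 p)) - chaos E n (\<lambda>p. g (z 0 n p)) - chaos E n (\<lambda>p. g (z n 0 p)) + chaos E n (\<lambda>p. g (z n n p))"
        by (simp add: chaos_def ghost_def z_def sum.distrib sum_subtractf algebra_simps)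
      then show "\<bar>chaos E n (ghost n (\<lambda>k l. g (Z k l \<omega>)))\<bar> \<le> (\<Sum>c\<in>{0, n}. \<Sum>d\<in>{0, n}. W c d E)"
        using W(2)[of 0 0 g E] W(2)[of 0 n g E] W(2)[of n 0 g E] W(2)[of n n g E] g n by simp
    qed
    then have "(\<Sum>E\<in>Pow {1..n}. Y E \<omega>) \<le> (\<Sum>E\<in>Pow {1..n}. ennreal (\<Sum>c\<in>{0, n}. \<Sum>d\<in>{0, n}. W c d E))"
      by (rule sum_mono)
    also have "\<dots> = ennreal (\<Sum>E\<in>Pow {1..n}. \<Sum>c\<in>{0, n}. \<Sum>d\<in>{0, n}. W c d E)"
      using W(1) by (intro sum_ennreal sum_nonneg)
    also have "(\<Sum>E\<in>Pow {1..n}. \<Sum>c\<in>{0, n}. \<Sum>d\<in>{0, n}. W c d E) = (\<Sum>c\<in>{0, n}. \<Sum>d\<in>{0, n}. \<Sum>E\<in>Pow {1..n}. W c d E)"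
      using n by (simp add: sum.distrib)
    also have "\<dots> \<le> (\<Sum>c\<in>{0, n}. \<Sum>d\<in>{0, n}. 2 ^ n * (L * ((\<Sum>p\<in>dyads n. (F (z c d p))\<^sup>2) / n + n) / 2))"
    proof (intro sum_mono)
      fix c d assume cd: "c \<in> {0, n}" "d \<in> {0, n}"
      define y where "y = (\<Sum>p\<in>dyads n. (F (z c d p))\<^sup>2)"
      have y: "0 \<le> y" by (simp add: y_def sum_nonneg)
      \<comment> \<open>The arithmetic-geometric mean inequality for \<open>y / n\<close> and
        \<open>n\<close> replaces the square root by an integrable expression. Since
        \<open>y\<close> has expectation of order \<open>n\<^sup>2\<close>, both summands are of
        order \<open>n\<close>.\<close>
      have "sqrt y \<le> (y / n + n) / 2"
        using arith_geo_mean_sqrt[of "y / n" n] y n by simp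
      then have "2 ^ n * (L * sqrt y) \<le> 2 ^ n * (L * ((y / n + n) / 2))"
        using L by (intro mult_left_mono) auto
      with W(3)[OF cd, folded y_def] have "(\<Sum>E\<in>Pow {1..n}. W c d E) \<le> 2 ^ n * (L * ((y / n + n) / 2))"
        by (rule order_trans)
      then show "(\<Sum>E\<in>Pow {1..n}. W c d E) \<le> 2 ^ n * (L * ((\<Sum>p\<in>dyads n. (F (z c d p))\<^sup>2) / n + n) / 2)"
        by (simp only: y_def times_divide_eq_right)
    qed
    finally show ?thesis
      by (simp only: z_def sum_distrib_left ennreal_leI)
  qed
  have FZ: "integrable M (\<lambda>\<omega>. (F (Z k l \<omega>))\<^sup>2)" "(\<integral>\<omega>. (F (Z k l \<omega>))\<^sup>2 \<partial>M) = m2"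
    if kl: "1 \<le> k" "1 \<le> l" "k \<noteq> l" for k l
  proof -
    show "integrable M (\<lambda>\<omega>. (F (Z k l \<omega>))\<^sup>2)"
      using F2 Z_measurable[OF kl] unfolding Z_law[OF kl, symmetric] by (subst (asm) integrable_distr_eq) auto
    show "(\<integral>\<omega>. (F (Z k l \<omega>))\<^sup>2 \<partial>M) = m2"
      using Z_measurable[OF kl] unfolding m2_def Z_law[OF kl, symmetric] by (subst integral_distr) auto
  qed
  let ?R = "\<lambda>\<omega>. 2 ^ n * (\<Sum>c\<in>{0, n}. \<Sum>d\<in>{0, n}. L * ((\<Sum>p\<in>dyads n. (F (Z (fst p + c) (snd p + d) \<omega>))\<^sup>2) / n + n) / 2)"
  have R_int: "integrable M ?R" and R_eq: "(\<integral>\<omega>. ?R \<omega> \<partial>M) = 2 ^ n * (2 * L * (card (dyads n) * m2 / n + n))"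
  proof -
    have s: "integrable M (\<lambda>\<omega>. \<Sum>p\<in>dyads n. (F (Z (fst p + c) (snd p + d) \<omega>))\<^sup>2)"
      "(\<integral>\<omega>. (\<Sum>p\<in>dyads n. (F (Z (fst p + c) (snd p + d) \<omega>))\<^sup>2) \<partial>M) = card (dyads n) * m2"
      if "c \<in> {0, n}" "d \<in> {0, n}" for c d
    proof -
      have "1 \<le> fst p + c" "1 \<le> snd p + d" "fst p + c \<noteq> snd p + d" if "p \<in> dyads n" for p
        using that \<open>c \<in> {0, n}\<close> \<open>d \<in> {0, n}\<close> by (auto simp: dyads_def)
      note * = FZ[OF this]
      show "integrable M (\<lambda>\<omega>. \<Sum>p\<in>dyads n. (F (Z (fst p + c) (snd p + d) \<omega>))\<^sup>2)"
        by (intro Bochner_Integration.integrable_sum *)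
      show "(\<integral>\<omega>. (\<Sum>p\<in>dyads n. (F (Z (fst p + c) (snd p + d) \<omega>))\<^sup>2) \<partial>M) = card (dyads n) * m2"
        by (subst Bochner_Integration.integral_sum) (simp_all add: *)
    qed
    have int: "integrable M (\<lambda>\<omega>. L * ((\<Sum>p\<in>dyads n. (F (Z (fst p + c) (snd p + d) \<omega>))\<^sup>2) / n + n) / 2)"
      if "c \<in> {0, n}" "d \<in> {0, n}" for c d
      using s(1)[OF that] by (intro integrable_divide_zero integrable_mult_right Bochner_Integration.integrable_add) auto
    then show "integrable M ?R"
      by (intro integrable_mult_right Bochner_Integration.integrable_sum)
    have "(\<integral>\<omega>. L * ((\<Sum>p\<in>dyads n. (F (Z (fst p + c) (snd p + d) \<omega>))\<^sup>2) / n + n) / 2 \<partial>M)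
        = L * (card (dyads n) * m2 / n + n) / 2" if "c \<in> {0, n}" "d \<in> {0, n}" for c d
      using s[OF that] by (simp add: prob_space)
    note eq = this
    have "(\<integral>\<omega>. ?R \<omega> \<partial>M) = 2 ^ n * (\<Sum>c\<in>{0, n}. \<Sum>d\<in>{0, n}.
        \<integral>\<omega>. L * ((\<Sum>p\<in>dyads n. (F (Z (fst p + c) (snd p + d) \<omega>))\<^sup>2) / n + n) / 2 \<partial>M)"
      unfolding integral_mult_right_zero
      by (intro arg_cong[where f="\<lambda>x. 2 ^ n * x"] trans[OF Bochner_Integration.integral_sum] sum.cong
          refl Bochner_Integration.integrable_sum int Bochner_Integration.integral_sum)
    also have "\<dots> = 2 ^ n * (\<Sum>c\<in>{0, n}. \<Sum>d\<in>{0, n}. L * (card (dyads n) * m2 / n + n) / 2)"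
      by (intro arg_cong[where f="\<lambda>x. 2 ^ n * x"] sum.cong refl eq)
    also have "\<dots> = 2 ^ n * (2 * L * (card (dyads n) * m2 / n + n))"
      using n by simp
    finally show "(\<integral>\<omega>. ?R \<omega> \<partial>M) = 2 ^ n * (2 * L * (card (dyads n) * m2 / n + n))" .
  qed
  \<comment> \<open>The factor \<open>2 ^ n\<close> is the number of sign patterns; it is cancelled
    at the end.\<close>
  have "2 ^ n * ?I = (\<Sum>E\<in>Pow {1..n}. \<integral>\<^sup>+\<omega>. Y E \<omega> \<partial>M)"
    using Y_eq by (simp add: card_Pow)
  also have "\<dots> = (\<integral>\<^sup>+\<omega>. (\<Sum>E\<in>Pow {1..n}. Y E \<omega>) \<partial>M)"
    by (intro nn_integral_sum[symmetric] Y_meas)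
  also have "\<dots> \<le> (\<integral>\<^sup>+\<omega>. ennreal (?R \<omega>) \<partial>M)"
    by (intro nn_integral_mono pointwise)
  also have "\<dots> = ennreal (2 ^ n * (2 * L * (card (dyads n) * m2 / n + n)))"
    unfolding R_eq[symmetric] using L
    by (intro nn_integral_eq_integral R_int AE_I2 mult_nonneg_nonneg sum_nonneg divide_nonneg_nonneg add_nonneg_nonneg) auto
  also have "\<dots> \<le> ennreal (2 ^ n * (2 * L * n * (m2 + 1)))"
  proof (intro ennreal_leI mult_left_mono)
    have "real (card (dyads n)) \<le> n\<^sup>2" using card_dyads_le[of n] by (simp flip: of_nat_power)
    then have "card (dyads n) * m2 / n \<le> n\<^sup>2 * m2 / n"
      using m2 by (intro divide_right_mono mult_right_mono) auto
    then have "card (dyads n) * m2 / n + n \<le> n * (m2 + 1)"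
      using n by (simp add: power2_eq_square algebra_simps)
    then have "2 * L * (card (dyads n) * m2 / n + n) \<le> 2 * L * (n * (m2 + 1))"
      using L by (intro mult_left_mono) auto
    then show "2 * L * (card (dyads n) * m2 / n + n) \<le> 2 * L * n * (m2 + 1)"
      by (simp add: mult.assoc)
  qed simp
  also have "\<dots> = 2 ^ n * ennreal (2 * L * n * (m2 + 1))"
    using L m2 by (subst ennreal_mult) (auto simp flip: ennreal_power)
  finally show ?thesis
    by (subst (asm) ennreal_mult_le_mult_iff) (auto simp: m2_def power_eq_top_ennreal)
qed

end

end

section \<open>The maximal inequality\<close>

theorem lemma2:
  fixes M :: "'w measure" and S :: "'s measure" and T :: "'t measure"
    and U :: "nat \<Rightarrow> 'w \<Rightarrow> 's" and V :: "nat \<Rightarrow> nat \<Rightarrow> 'w \<Rightarrow> 't"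
    and \<tau> :: "'s \<Rightarrow> 's \<Rightarrow> 't \<Rightarrow> real \<times> (real^'d)" and \<X> :: "(real^'d) set"
    and \<F> :: "(real \<times> (real^'d) \<Rightarrow> real) set" and F :: "real \<times> (real^'d) \<Rightarrow> real"
  assumes "dyadic_array M S T U V \<tau> \<X>"
    and "\<F> \<subseteq> borel_measurable (obs_space \<X>)"
    and "pointwise_measurable (space (obs_space \<X>)) \<F>"
    and "F \<in> borel_measurable (obs_space \<X>)"
    and "VC_type (obs_space \<X>) \<F> F"
    and "integrable (obs_law M U V \<tau> \<X>) (\<lambda>z. (F z)\<^sup>2)"
  shows "\<exists>C::real. \<forall>\<^sub>F n in sequentially.
           (\<integral>\<^sup>+ \<omega>. (SUP f\<in>\<F>. ennreal \<bar>dyadic_mean U V n (proj2 M U V \<tau> \<X> f) \<omega>\<bar>) \<partial>M)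
             \<le> ennreal (C / real n)"
proof (rule VC_type_chaos_bound[OF assms(5,4,2)])
  interpret dyadic_array M S T U V \<tau> \<X> by fact
  note F = assms(4) and F2 = assms(6) and F_sub = assms(2)
  \<comment> \<open>The constant is fixed before the sample size, so the final bound has a constant
    independent of \<open>n\<close>.\<close>
  fix L :: real
  assume L: "0 \<le> L"
    and chaos_bound: "\<And>n z. z ` dyads n \<subseteq> space (obs_space \<X>) \<Longrightarrow>
      \<exists>W. (\<forall>E. 0 \<le> W E \<and> (\<forall>f\<in>\<F>. \<bar>chaos E n (\<lambda>p. f (z p))\<bar> \<le> W E)) \<and>
        (\<Sum>E\<in>Pow {1..n}. W E) \<le> 2 ^ n * (L * sqrt (\<Sum>p\<in>dyads n. (F (z p))\<^sup>2))"
  have env: "\<bar>f z\<bar> \<le> F z" if "f \<in> \<F>" "z \<in> space (obs_space \<X>)" for f z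
    using assms(5) that by (auto simp: VC_type_def)
  obtain \<G> where G: "\<G> \<subseteq> \<F>" "countable \<G>"
    and Glim: "\<And>f. f \<in> \<F> \<Longrightarrow> \<exists>g. (\<forall>k. g k \<in> \<G>) \<and> (\<forall>z\<in>space (obs_space \<X>). (\<lambda>k. g k z) \<longlonglongrightarrow> f z)"
    using assms(3) unfolding pointwise_measurable_def by metis
  interpret P: prob_space "obs_law M U V \<tau> \<X>"
    unfolding obs_law_def by (rule prob_space_distr) (rule dyad_obs_measurable)
  have F_int: "integrable (obs_law M U V \<tau> \<X>) F"
    by (rule P.square_integrable_imp_integrable[OF _ F2]) (use F in \<open>simp add: obs_law_def\<close>)
  define m2 where "m2 = (\<integral>z. (F z)\<^sup>2 \<partial>obs_law M U V \<tau> \<X>)"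
  have m2: "0 \<le> m2" by (simp add: m2_def)
  have bound: "(\<integral>\<^sup>+ \<omega>. (SUP f\<in>\<F>. ennreal \<bar>dyadic_mean U V n (proj2 M U V \<tau> \<X> f) \<omega>\<bar>) \<partial>M)
      \<le> ennreal (8 * L * (m2 + 1) / real n)" if n: "2 \<le> n" for n
  proof -
    define N where "N = real n * (real n - 1) / 2"
    have N: "0 < N" using n by (simp add: N_def)
    let ?I = "\<lambda>\<omega>. \<integral>\<^sup>+\<omega>'. (SUP g\<in>\<G>. ennreal \<bar>\<Sum>p\<in>dyads n. mix g n \<omega> \<omega>' p\<bar>) \<partial>M"
    \<comment> \<open>The bound holds almost surely and simultaneously for all functions of the
      class; only the right-hand side has to be measurable for the integration that follows.\<close>
    have "AE \<omega> in M. (SUP f\<in>\<F>. ennreal \<bar>dyadic_mean U V n (proj2 M U V \<tau> \<X> f) \<omega>\<bar>) \<le> ennreal (1 / N) * ?I \<omega>"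
      using AE_rest_integrable[OF F F_int, of n]
    proof (rule AE_mp, intro AE_I2 impI SUP_least)
      fix \<omega> f assume \<omega>: "\<omega> \<in> space M" and f: "f \<in> \<F>"
        and good: "\<forall>i\<in>{1..n}. integrable (distr M (S \<Otimes>\<^sub>M T) (\<lambda>\<omega>. (U 2 \<omega>, V 1 2 \<omega>))) (\<lambda>y. F (\<tau> (U i \<omega>) (fst y) (snd y)))"
      obtain g where g: "\<And>k. g k \<in> \<G>" "\<And>z. z \<in> space (obs_space \<X>) \<Longrightarrow> (\<lambda>k. g k z) \<longlonglongrightarrow> f z"
        using Glim[OF f] by blast
      let ?s = "\<Sum>(i, j)\<in>dyads n. proj2 M U V \<tau> \<X> f (U i \<omega>) (U j \<omega>) (V i j \<omega>)"
      have "dyadic_mean U V n (proj2 M U V \<tau> \<X> f) \<omega> = ?s / N"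
        unfolding dyadic_mean_def N_def dyads_eq_Sigma by (subst sum.Sigma) auto
      then have "ennreal \<bar>dyadic_mean U V n (proj2 M U V \<tau> \<X> f) \<omega>\<bar> = ennreal (1 / N) * ennreal \<bar>?s\<bar>"
        using N by (simp add: abs_divide flip: ennreal_mult)
      also have "ennreal \<bar>?s\<bar> \<le> ?I \<omega>"
        using f F_sub env good by (intro proj2_le_mix[OF _ _ F_int \<omega> _ g]) auto
      finally show "ennreal \<bar>dyadic_mean U V n (proj2 M U V \<tau> \<X> f) \<omega>\<bar> \<le> ennreal (1 / N) * ?I \<omega>"
        by (simp add: mult_left_mono)
    qed
    then have "(\<integral>\<^sup>+ \<omega>. (SUP f\<in>\<F>. ennreal \<bar>dyadic_mean U V n (proj2 M U V \<tau> \<X> f) \<omega>\<bar>) \<partial>M)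
        \<le> (\<integral>\<^sup>+\<omega>. ennreal (1 / N) * ?I \<omega> \<partial>M)"
      by (rule nn_integral_mono_AE)
    also have "\<dots> = ennreal (1 / N) * (\<integral>\<^sup>+\<omega>. ?I \<omega> \<partial>M)"
      using G F_sub by (intro nn_integral_cmult mix_decouple(1)) auto
    also have "(\<integral>\<^sup>+\<omega>. ?I \<omega> \<partial>M)
        = (\<integral>\<^sup>+\<omega>. (SUP g\<in>\<G>. ennreal \<bar>\<Sum>p\<in>dyads n. ghost n (\<lambda>k l. g (dyad_obs U V \<tau> k l \<omega>)) p\<bar>) \<partial>M)"
      using G F_sub by (intro mix_decouple(2)) auto
    also have "\<dots> \<le> ennreal (2 * L * n * (m2 + 1))"
      unfolding m2_def
    proof (rule nn_integral_Sup_ghost_le[OF G(2) _ _ F F2 L])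
      show "\<exists>W. (\<forall>E. 0 \<le> W E \<and> (\<forall>g\<in>\<G>. \<bar>chaos E n (\<lambda>p. g (z p))\<bar> \<le> W E)) \<and>
        (\<Sum>E\<in>Pow {1..n}. W E) \<le> 2 ^ n * (L * sqrt (\<Sum>p\<in>dyads n. (F (z p))\<^sup>2))"
        if "z ` dyads n \<subseteq> space (obs_space \<X>)" for z
        using chaos_bound[OF that] G(1) by blast
    qed (use G F_sub n in auto)
    also have "ennreal (1 / N) * ennreal (2 * L * n * (m2 + 1)) = ennreal (1 / N * (2 * L * n * (m2 + 1)))"
      using N L m2 by (intro ennreal_mult[symmetric]) auto
    also have "1 / N * (2 * L * n * (m2 + 1)) \<le> 8 * L * (m2 + 1) / n"
    proof -
      \<comment> \<open>Dividing the order \<open>n\<close> bound by the number of dyads leaves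
        \<open>4 / (n - 1)\<close>, which is at most \<open>8 / n\<close> because \<open>n\<close>
        is at least 2.\<close>
      have "1 / N * (2 * L * n * (m2 + 1)) = 4 * (L * (m2 + 1)) / (real n - 1)"
        using n by (simp add: N_def field_simps)
      also have "\<dots> \<le> 4 * (L * (m2 + 1)) / (real n / 2)"
        using n L m2 by (intro divide_left_mono mult_nonneg_nonneg mult_pos_pos) auto
      finally show ?thesis by (simp add: mult_ac)
    qed
    finally show ?thesis by (simp add: mult_left_mono ennreal_leI)
  qed
  show ?thesis
    using bound by (intro exI[of _ "8 * L * (m2 + 1)"] eventually_sequentiallyI[of 2]) simp
qed

end
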